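(* Let $n\ge 1$, let $q\in\mathbb{C}$ be nonzero, and let $\mathcal{A}_q(n)[x_1^{-1}]$ be the quantum $n$-space $\mathcal{A}_q(n)$ extended by the inverse $x_1^{-1}$ of $x_1$. Let $\Delta:\mathcal{A}_q(n)[x_1^{-1}]\to \mathcal{A}_q(n)[x_1^{-1}]\otimes \mathcal{A}_q(n)[x_1^{-1}]$ and $\varepsilon:\mathcal{A}_q(n)[x_1^{-1}]\to\mathbb{C}$ be the algebra homomorphisms, and $S:\mathcal{A}_q(n)[x_1^{-1}]\to\mathcal{A}_q(n)[x_1^{-1}]$ the algebra antihomomorphism, acting on the generators by $$\Delta(x_1^{\pm1})=x_1^{\pm1}\otimes x_1^{\pm1},\qquad \Delta(x_i)=x_i\otimes x_1+x_1\otimes x_i\quad(1<i\le n),$$ $$\varepsilon(x_1)=1,\qquad \varepsilon(x_i)=0\quad(1<i\le n),$$ $$S(x_1)=x_1^{-1},\qquad S(x_i)=-x_1^{-1}x_ix_1^{-1}\quad(1<i\le n).$$ Then $\mathcal{A}_q(n)[x_1^{-1}]$ is a cocommutative Hopf algebra with coproduct $\Delta$, counit $\varepsilon$ and antipode $S$.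
   Context: The ground field is $\mathbb{C}$. For $\alpha,\beta\in\mathbb{Z}^n$ put $\alpha\ast\beta=\sum_{j=1}^{n-1}\sum_{i>j}(j-i)\alpha_i\beta_j$ and $\eta(\alpha,\beta)=q^{\alpha\ast\beta-\beta\ast\alpha}$. Let $\varepsilon_1,\dots,\varepsilon_n$ be the standard basis of $\mathbb{Z}^n$; then $\eta(\varepsilon_i,\varepsilon_j)=q^{j-i}$. (The counit $\varepsilon$ is not to be confused with the vectors $\varepsilon_i$.) The quantum $n$-space $\mathcal{A}_q(n)$ is the unital associative $\mathbb{C}$-algebra generated by $x_1,\dots,x_n$ subject to the relations $x_ix_j=\eta(\varepsilon_i,\varepsilon_j)\,x_jx_i$ for $1\le i,j\le n$. The extended algebra $\mathcal{A}_q(n)[x_1^{-1}]$ is obtained by adjoining a two-sided inverse $x_1^{-1}$ of $x_1$; it has as vector space basis the ordered monomials $x^\alpha=x_1^{\alpha_1}\cdots x_n^{\alpha_n}$ with $\alpha\in\mathbb{Z}\times\mathbb{Z}_{\ge0}^{n-1}$. The tensor product of algebras carries the usual multiplication $(a\otimes b)(c\otimes d)=ac\otimes bd$. Cocommutative means $\Delta=\tau\circ\Delta$, where $\tau(a\otimes b)=b\otimes a$. *)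

theory Defs
  imports Complex_Main "HOL-Library.FuncSet" "HOL-Library.Poly_Mapping" "HOL-Algebra.QuotRing" "HOL-Algebra.Module"
begin

section \<open>Associative algebras over the complex numbers\<close>

text \<open>
  Algebras are records of type \<open>(complex, 'a) module\<close>. The locale \<open>algebra\<close> of HOL-Algebra is
  restricted to commutative algebras, hence the new locale below.
\<close>

definition complex_alg :: "(complex, complex) module" where
  "complex_alg = \<lparr>carrier = UNIV, mult = (*), one = 1, zero = 0, add = (+), smult = (*)\<rparr>"

locale complex_algebra = Module.module complex_alg A + ring A for A (structure) +
  assumes smult_mult_left: "\<lbrakk>x \<in> carrier A; y \<in> carrier A\<rbrakk>
      \<Longrightarrow> (c \<odot>\<^bsub>A\<^esub> x) \<otimes>\<^bsub>A\<^esub> y = c \<odot>\<^bsub>A\<^esub> (x \<otimes>\<^bsub>A\<^esub> y)"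
    and smult_mult_right: "\<lbrakk>x \<in> carrier A; y \<in> carrier A\<rbrakk>
      \<Longrightarrow> x \<otimes>\<^bsub>A\<^esub> (c \<odot>\<^bsub>A\<^esub> y) = c \<odot>\<^bsub>A\<^esub> (x \<otimes>\<^bsub>A\<^esub> y)"

definition linear_map ::
  "(complex, 'a) module \<Rightarrow> (complex, 'b) module \<Rightarrow> ('a \<Rightarrow> 'b) \<Rightarrow> bool" where
  "linear_map V W f \<longleftrightarrow> f \<in> carrier V \<rightarrow> carrier W
     \<and> (\<forall>x\<in>carrier V. \<forall>y\<in>carrier V. f (x \<oplus>\<^bsub>V\<^esub> y) = f x \<oplus>\<^bsub>W\<^esub> f y)
     \<and> (\<forall>c. \<forall>x\<in>carrier V. f (c \<odot>\<^bsub>V\<^esub> x) = c \<odot>\<^bsub>W\<^esub> f x)"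

definition algebra_hom ::
  "(complex, 'a) module \<Rightarrow> (complex, 'b) module \<Rightarrow> ('a \<Rightarrow> 'b) \<Rightarrow> bool" where
  "algebra_hom A B f \<longleftrightarrow> linear_map A B f \<and> f \<in> ring_hom A B"

definition algebra_antihom ::
  "(complex, 'a) module \<Rightarrow> (complex, 'b) module \<Rightarrow> ('a \<Rightarrow> 'b) \<Rightarrow> bool" where
  "algebra_antihom A B f \<longleftrightarrow> algebra_hom A (B\<lparr>mult := \<lambda>x y. y \<otimes>\<^bsub>B\<^esub> x\<rparr>) f"

definition quot_algebra :: "(complex, 'a) module \<Rightarrow> 'a set \<Rightarrow> (complex, 'a set) module" where
  "quot_algebra A I = \<lparr>carrier = carrier (A Quot I), mult = mult (A Quot I),
     one = one (A Quot I), zero = zero (A Quot I), add = add (A Quot I),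
     smult = (\<lambda>c X. \<Union>x\<in>X. I +>\<^bsub>A\<^esub> (c \<odot>\<^bsub>A\<^esub> x))\<rparr>"

abbreviation scale_pm :: "complex \<Rightarrow> ('m \<Rightarrow>\<^sub>0 complex) \<Rightarrow> ('m \<Rightarrow>\<^sub>0 complex)" where
  "scale_pm c \<equiv> Poly_Mapping.map ((*) c)"

text \<open>
  The monoid algebra: the vector space with basis \<open>carrier G\<close>, with the product of \<open>G\<close> extended
  bilinearly.
\<close>

definition monoid_algebra :: "'m monoid \<Rightarrow> (complex, 'm \<Rightarrow>\<^sub>0 complex) module" where
  "monoid_algebra G =
     \<lparr>carrier = {f. Poly_Mapping.keys f \<subseteq> carrier G},
      mult = (\<lambda>f g. \<Sum>a\<in>Poly_Mapping.keys f. \<Sum>b\<in>Poly_Mapping.keys g.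
         Poly_Mapping.single (a \<otimes>\<^bsub>G\<^esub> b) (Poly_Mapping.lookup f a * Poly_Mapping.lookup g b)),
      one = Poly_Mapping.single \<one>\<^bsub>G\<^esub> 1, zero = 0, add = (+), smult = scale_pm\<rparr>"


section \<open>Algebras given by generators and relations\<close>

definition free_algebra :: "'g set \<Rightarrow> (complex, 'g list \<Rightarrow>\<^sub>0 complex) module" where
  "free_algebra X = monoid_algebra \<lparr>carrier = lists X, mult = (@), one = []\<rparr>"

text \<open>The free algebra on \<open>X\<close> modulo the two-sided ideal generated by the relators \<open>R\<close>.\<close>

definition presented_algebra ::
  "'g set \<Rightarrow> ('g list \<Rightarrow>\<^sub>0 complex) set \<Rightarrow> (complex, ('g list \<Rightarrow>\<^sub>0 complex) set) module" where
  "presented_algebra X R = quot_algebra (free_algebra X) (genideal (free_algebra X) R)"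

definition presented_gen ::
  "'g set \<Rightarrow> ('g list \<Rightarrow>\<^sub>0 complex) set \<Rightarrow> 'g \<Rightarrow> ('g list \<Rightarrow>\<^sub>0 complex) set" where
  "presented_gen X R g =
     genideal (free_algebra X) R +>\<^bsub>free_algebra X\<^esub> Poly_Mapping.single [g] 1"


section \<open>Tensor products\<close>

text \<open>
  The tensor product is the free vector space on the pairs (see \<open>tensor_elem\<close> for \<open>a \<otimes> b\<close>) modulo
  the linear span of the bilinearity relators. Giving the free vector space the product of the
  monoid algebra of \<open>A \<times>\<times> B\<close> makes the induced product \<open>(a \<otimes> b) (c \<otimes> d) = a c \<otimes> b d\<close>.
\<close>

definition bilinear_relators ::
  "(complex, 'a) module \<Rightarrow> (complex, 'b) module \<Rightarrow> ('a \<times> 'b \<Rightarrow>\<^sub>0 complex) set" where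
  "bilinear_relators A B =
     {Poly_Mapping.single (a \<oplus>\<^bsub>A\<^esub> a', b) 1 - Poly_Mapping.single (a, b) 1
        - Poly_Mapping.single (a', b) 1
        | a a' b. a \<in> carrier A \<and> a' \<in> carrier A \<and> b \<in> carrier B}
   \<union> {Poly_Mapping.single (a, b \<oplus>\<^bsub>B\<^esub> b') 1 - Poly_Mapping.single (a, b) 1
        - Poly_Mapping.single (a, b') 1
        | a b b'. a \<in> carrier A \<and> b \<in> carrier B \<and> b' \<in> carrier B}
   \<union> {Poly_Mapping.single (c \<odot>\<^bsub>A\<^esub> a, b) 1 - Poly_Mapping.single (a, b) c
        | c a b. a \<in> carrier A \<and> b \<in> carrier B}
   \<union> {Poly_Mapping.single (a, c \<odot>\<^bsub>B\<^esub> b) 1 - Poly_Mapping.single (a, b) c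
        | c a b. a \<in> carrier A \<and> b \<in> carrier B}"

definition bilinear_span ::
  "(complex, 'a) module \<Rightarrow> (complex, 'b) module \<Rightarrow> ('a \<times> 'b \<Rightarrow>\<^sub>0 complex) set" where
  "bilinear_span A B = module.span scale_pm (bilinear_relators A B)"

definition tensor_algebra ::
  "(complex, 'a) module \<Rightarrow> (complex, 'b) module \<Rightarrow> (complex, ('a \<times> 'b \<Rightarrow>\<^sub>0 complex) set) module"
  where
  "tensor_algebra A B = quot_algebra (monoid_algebra (A \<times>\<times> B)) (bilinear_span A B)"

definition tensor_elem ::
  "(complex, 'a) module \<Rightarrow> (complex, 'b) module \<Rightarrow> 'a \<Rightarrow> 'b \<Rightarrow> ('a \<times> 'b \<Rightarrow>\<^sub>0 complex) set" where
  "tensor_elem A B a b =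
     bilinear_span A B +>\<^bsub>monoid_algebra (A \<times>\<times> B)\<^esub> Poly_Mapping.single (a, b) 1"

text \<open>
  The linear map into \<open>V\<close> with \<open>a \<otimes> b \<mapsto> \<beta> a b\<close>, for bilinear \<open>\<beta>\<close>. It is computed on an arbitrary
  representative of the coset \<open>t\<close>; the image below is a singleton when \<open>\<beta>\<close> is bilinear.
\<close>

definition tensor_lift ::
  "(complex, 'v) module \<Rightarrow> ('a \<Rightarrow> 'b \<Rightarrow> 'v) \<Rightarrow> ('a \<times> 'b \<Rightarrow>\<^sub>0 complex) set \<Rightarrow> 'v" where
  "tensor_lift V \<beta> t = the_elem
     ((\<lambda>F. finsum V (\<lambda>p. Poly_Mapping.lookup F p \<odot>\<^bsub>V\<^esub> \<beta> (fst p) (snd p)) (Poly_Mapping.keys F)) ` t)"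

definition tensor_map ::
  "(complex, 'c) module \<Rightarrow> (complex, 'd) module \<Rightarrow> ('a \<Rightarrow> 'c) \<Rightarrow> ('b \<Rightarrow> 'd)
    \<Rightarrow> ('a \<times> 'b \<Rightarrow>\<^sub>0 complex) set \<Rightarrow> ('c \<times> 'd \<Rightarrow>\<^sub>0 complex) set" where
  "tensor_map C D f g = tensor_lift (tensor_algebra C D) (\<lambda>a b. tensor_elem C D (f a) (g b))"

definition tensor_flip ::
  "(complex, 'a) module \<Rightarrow> (complex, 'b) module
    \<Rightarrow> ('a \<times> 'b \<Rightarrow>\<^sub>0 complex) set \<Rightarrow> ('b \<times> 'a \<Rightarrow>\<^sub>0 complex) set" where
  "tensor_flip A B = tensor_lift (tensor_algebra B A) (\<lambda>a b. tensor_elem B A b a)"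

text \<open>The canonical map \<open>(A \<otimes> B) \<otimes> C \<rightarrow> A \<otimes> (B \<otimes> C)\<close>.\<close>

definition tensor_assoc ::
  "(complex, 'a) module \<Rightarrow> (complex, 'b) module \<Rightarrow> (complex, 'c) module
    \<Rightarrow> (('a \<times> 'b \<Rightarrow>\<^sub>0 complex) set \<times> 'c \<Rightarrow>\<^sub>0 complex) set
    \<Rightarrow> ('a \<times> ('b \<times> 'c \<Rightarrow>\<^sub>0 complex) set \<Rightarrow>\<^sub>0 complex) set" where
  "tensor_assoc A B C =
     tensor_lift (tensor_algebra A (tensor_algebra B C))
       (\<lambda>t c. tensor_lift (tensor_algebra A (tensor_algebra B C))
          (\<lambda>a b. tensor_elem A (tensor_algebra B C) a (tensor_elem B C b c)) t)"

text \<open>The canonical maps \<open>\<complex> \<otimes> V \<rightarrow> V\<close> and \<open>V \<otimes> \<complex> \<rightarrow> V\<close>.\<close>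

definition tensor_unit_left ::
  "(complex, 'v) module \<Rightarrow> (complex \<times> 'v \<Rightarrow>\<^sub>0 complex) set \<Rightarrow> 'v" where
  "tensor_unit_left V = tensor_lift V (\<lambda>c v. c \<odot>\<^bsub>V\<^esub> v)"

definition tensor_unit_right ::
  "(complex, 'v) module \<Rightarrow> ('v \<times> complex \<Rightarrow>\<^sub>0 complex) set \<Rightarrow> 'v" where
  "tensor_unit_right V = tensor_lift V (\<lambda>v c. c \<odot>\<^bsub>V\<^esub> v)"

definition tensor_mult :: "(complex, 'a) module \<Rightarrow> ('a \<times> 'a \<Rightarrow>\<^sub>0 complex) set \<Rightarrow> 'a" where
  "tensor_mult A = tensor_lift A (\<lambda>a b. a \<otimes>\<^bsub>A\<^esub> b)"


section \<open>Hopf algebras\<close>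

locale complex_coalgebra = Module.module complex_alg C for C (structure)
    and \<Delta> :: "'a \<Rightarrow> ('a \<times> 'a \<Rightarrow>\<^sub>0 complex) set" and \<epsilon> :: "'a \<Rightarrow> complex" +
  assumes comult_linear: "linear_map C (tensor_algebra C C) \<Delta>"
    and counit_linear: "linear_map C complex_alg \<epsilon>"
    and coassoc: "a \<in> carrier C \<Longrightarrow>
      tensor_assoc C C C (tensor_map (tensor_algebra C C) C \<Delta> id (\<Delta> a))
        = tensor_map C (tensor_algebra C C) id \<Delta> (\<Delta> a)"
    and counit_left: "a \<in> carrier C \<Longrightarrow>
      tensor_unit_left C (tensor_map complex_alg C \<epsilon> id (\<Delta> a)) = a"
    and counit_right: "a \<in> carrier C \<Longrightarrow>
      tensor_unit_right C (tensor_map C complex_alg id \<epsilon> (\<Delta> a)) = a"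

locale complex_bialgebra = complex_algebra A + complex_coalgebra A \<Delta> \<epsilon>
  for A (structure) and \<Delta> and \<epsilon> +
  assumes comult_hom: "algebra_hom A (tensor_algebra A A) \<Delta>"
    and counit_hom: "algebra_hom A complex_alg \<epsilon>"

locale complex_hopf_algebra = complex_bialgebra A \<Delta> \<epsilon>
  for A (structure) and \<Delta> and \<epsilon> and S :: "'a \<Rightarrow> 'a" +
  assumes antipode_linear: "linear_map A A S"
    and antipode_left: "a \<in> carrier A \<Longrightarrow>
      tensor_mult A (tensor_map A A S id (\<Delta> a)) = \<epsilon> a \<odot>\<^bsub>A\<^esub> \<one>\<^bsub>A\<^esub>"
    and antipode_right: "a \<in> carrier A \<Longrightarrow>
      tensor_mult A (tensor_map A A id S (\<Delta> a)) = \<epsilon> a \<odot>\<^bsub>A\<^esub> \<one>\<^bsub>A\<^esub>"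

definition cocommutative ::
  "(complex, 'a) module \<Rightarrow> ('a \<Rightarrow> ('a \<times> 'a \<Rightarrow>\<^sub>0 complex) set) \<Rightarrow> bool" where
  "cocommutative A \<Delta> \<longleftrightarrow> (\<forall>a\<in>carrier A. \<Delta> a = tensor_flip A A (\<Delta> a))"


section \<open>Quantum space extended by the inverse of its first generator\<close>

text \<open>Vectors of \<open>\<int>\<^sup>n\<close> are functions \<open>nat \<Rightarrow> int\<close> of which only the values at \<open>1, \<dots>, n\<close> matter.\<close>

definition star :: "nat \<Rightarrow> (nat \<Rightarrow> int) \<Rightarrow> (nat \<Rightarrow> int) \<Rightarrow> int" where
  "star n \<alpha> \<beta> = (\<Sum>j\<in>{1..n-1}. \<Sum>i\<in>{j<..n}. (int j - int i) * \<alpha> i * \<beta> j)"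

definition eta :: "nat \<Rightarrow> complex \<Rightarrow> (nat \<Rightarrow> int) \<Rightarrow> (nat \<Rightarrow> int) \<Rightarrow> complex" where
  "eta n q \<alpha> \<beta> = q powi (star n \<alpha> \<beta> - star n \<beta> \<alpha>)"

definition unit_vec :: "nat \<Rightarrow> nat \<Rightarrow> int" where
  "unit_vec i = (\<lambda>k. if k = i then 1 else 0)"

lemma star_unit_vec:
  assumes "i \<in> {1..n}" "j \<in> {1..n}"
  shows "star n (unit_vec i) (unit_vec j) = (if j < i then int j - int i else 0)"
proof -
  have "star n (unit_vec i) (unit_vec j)
      = (\<Sum>l\<in>{1..n-1}. if l = j then (\<Sum>k\<in>{l<..n}. if k = i then int l - int i else 0) else 0)"
    unfolding star_def unit_vec_def
    by (intro sum.cong refl)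
      (simp add: if_distrib[where f = "\<lambda>x. _ * x"] if_distrib[where f = "\<lambda>x. x * _"] cong: if_cong)
  also have "\<dots> = (if j < i then int j - int i else 0)"
    using assms by (auto simp: sum.delta)
  finally show ?thesis .
qed

lemma eta_unit_vec:
  assumes "i \<in> {1..n}" "j \<in> {1..n}"
  shows "eta n q (unit_vec i) (unit_vec j) = q powi (int j - int i)"
  using assms by (auto simp: eta_def star_unit_vec)

datatype qgen = X nat | X1inv

definition qspace_relators :: "nat \<Rightarrow> complex \<Rightarrow> (qgen list \<Rightarrow>\<^sub>0 complex) set" where
  "qspace_relators n q =
     {Poly_Mapping.single [X i, X j] 1
        - Poly_Mapping.single [X j, X i] (eta n q (unit_vec i) (unit_vec j))
        | i j. i \<in> {1..n} \<and> j \<in> {1..n}}"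

definition inverse_relators :: "(qgen list \<Rightarrow>\<^sub>0 complex) set" where
  "inverse_relators =
     {Poly_Mapping.single [X 1, X1inv] 1 - Poly_Mapping.single [] 1,
      Poly_Mapping.single [X1inv, X 1] 1 - Poly_Mapping.single [] 1}"

definition ext_qspace_gens :: "nat \<Rightarrow> qgen set" where
  "ext_qspace_gens n = X ` {1..n} \<union> {X1inv}"

definition ext_qspace :: "nat \<Rightarrow> complex \<Rightarrow> (complex, (qgen list \<Rightarrow>\<^sub>0 complex) set) module" where
  "ext_qspace n q =
     presented_algebra (ext_qspace_gens n) (qspace_relators n q \<union> inverse_relators)"

definition qx :: "nat \<Rightarrow> complex \<Rightarrow> nat \<Rightarrow> (qgen list \<Rightarrow>\<^sub>0 complex) set" where
  "qx n q i = presented_gen (ext_qspace_gens n) (qspace_relators n q \<union> inverse_relators) (X i)"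

definition qx1inv :: "nat \<Rightarrow> complex \<Rightarrow> (qgen list \<Rightarrow>\<^sub>0 complex) set" where
  "qx1inv n q = presented_gen (ext_qspace_gens n) (qspace_relators n q \<union> inverse_relators) X1inv"

definition is_coproduct ::
  "nat \<Rightarrow> complex \<Rightarrow> ((qgen list \<Rightarrow>\<^sub>0 complex) set
    \<Rightarrow> ((qgen list \<Rightarrow>\<^sub>0 complex) set \<times> (qgen list \<Rightarrow>\<^sub>0 complex) set \<Rightarrow>\<^sub>0 complex) set) \<Rightarrow> bool" where
  "is_coproduct n q \<Delta> \<longleftrightarrow>
     (let A = ext_qspace n q; x = qx n q; y = qx1inv n q; T = tensor_algebra A A;
          tens = tensor_elem A A in
      algebra_hom A T \<Delta> \<and> \<Delta> (x 1) = tens (x 1) (x 1) \<and> \<Delta> y = tens y y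
      \<and> (\<forall>i. 1 < i \<and> i \<le> n \<longrightarrow> \<Delta> (x i) = tens (x i) (x 1) \<oplus>\<^bsub>T\<^esub> tens (x 1) (x i)))"

definition is_counit ::
  "nat \<Rightarrow> complex \<Rightarrow> ((qgen list \<Rightarrow>\<^sub>0 complex) set \<Rightarrow> complex) \<Rightarrow> bool" where
  "is_counit n q \<epsilon> \<longleftrightarrow> algebra_hom (ext_qspace n q) complex_alg \<epsilon> \<and> \<epsilon> (qx n q 1) = 1
     \<and> (\<forall>i. 1 < i \<and> i \<le> n \<longrightarrow> \<epsilon> (qx n q i) = 0)"

definition is_antipode ::
  "nat \<Rightarrow> complex \<Rightarrow> ((qgen list \<Rightarrow>\<^sub>0 complex) set \<Rightarrow> (qgen list \<Rightarrow>\<^sub>0 complex) set) \<Rightarrow> bool" where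
  "is_antipode n q S \<longleftrightarrow>
     (let A = ext_qspace n q; x = qx n q; y = qx1inv n q in
      algebra_antihom A A S \<and> S (x 1) = y
      \<and> (\<forall>i. 1 < i \<and> i \<le> n \<longrightarrow> S (x i) = \<ominus>\<^bsub>A\<^esub> (y \<otimes>\<^bsub>A\<^esub> x i \<otimes>\<^bsub>A\<^esub> y)))"

end

theory Submission
  imports Defs
begin

text \<open>
  The algebra is given by generators and relations, and its coproduct, counit and antipode are
  prescribed on generators, so everything is an application of two universal properties: that of
  an algebra given by a presentation (\<open>presented_lift\<close> for existence, \<open>presented_hom_eqI\<close> for
  uniqueness) and that of the tensor product (\<open>tensor_lift_tens\<close>, \<open>tensor_lift_linear\<close>). Both come
  from extending a map linearly from a basis to formal linear combinations and factoring the
  extension through a quotient.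

  Existence of the three structure maps means that the prescribed values satisfy the defining
  relations. The value on the inverse of \<open>x\<^sub>1\<close> is forced, so a homomorphism to an algebra \<open>B\<close> amounts
  to elements \<open>u\<^sub>i\<close> with \<open>u\<^sub>i u\<^sub>j = q\<^bsup>j-i\<^esup> u\<^sub>j u\<^sub>i\<close> and \<open>u\<^sub>1\<close> invertible (\<open>ext_qspace_universal\<close>); for the
  antipode, \<open>B\<close> is the opposite algebra. The prescribed values treat \<open>x\<^sub>1\<close> differently from the other
  generators, but \<open>x\<^sub>1 \<otimes> x\<^sub>1\<close> is half of \<open>x\<^sub>i \<otimes> x\<^sub>1 + x\<^sub>1 \<otimes> x\<^sub>i\<close> at \<open>i = 1\<close>, and \<open>y\<close> is \<open>y x\<^sub>i y\<close> at \<open>i = 1\<close>,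
  where \<open>y\<close> is the inverse of \<open>x\<^sub>1\<close>. Rescaling generators does not affect the relations
  (\<open>scaled_comm\<close>), so each of them is one computation, uniform in \<open>i\<close> and \<open>j\<close>. In that
  of the coproduct (\<open>skew_primitive_comm\<close>) the two mixed terms are exchanged, each with the
  factor \<open>q\<^bsup>1-i\<^esup> q\<^bsup>j-1\<^esup> = q\<^bsup>j-i\<^esup>\<close>.

  Coassociativity, the counit laws and cocommutativity equate two algebra homomorphisms, so it is
  enough to compare them on generators. The antipode laws do not, because \<open>m \<circ> (S \<otimes> id)\<close> is not
  multiplicative. However, if \<open>m (S \<otimes> id) s = k 1\<close> then
  \<open>m (S \<otimes> id) (s t) = k m (S \<otimes> id) t\<close> (\<open>antipode_left_mult\<close>), since the scalar \<open>k 1\<close> ends up between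
  the two factors of \<open>t\<close> and can be pulled out. Hence the elements that satisfy an antipode law
  form a subalgebra, and generators suffice again (\<open>hopf_algebra_if_gens\<close>).
\<close>

section \<open>Vector spaces, algebras and linear maps\<close>

lemma complex_alg_simps [simp]:
  "carrier complex_alg = UNIV" "mult complex_alg = (*)" "one complex_alg = 1"
  "zero complex_alg = 0" "add complex_alg = (+)" "smult complex_alg = (*)"
  by (simp_all add: complex_alg_def)

lemma cring_complex_alg: "cring complex_alg"
proof (rule cringI)
  show "abelian_group complex_alg"
  proof (rule abelian_groupI)
    fix x :: complex
    show "\<exists>y\<in>carrier complex_alg. y \<oplus>\<^bsub>complex_alg\<^esub> x = \<zero>\<^bsub>complex_alg\<^esub>"
      by (rule bexI[of _ "- x"]) auto
  qed auto
  show "Group.comm_monoid complex_alg"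
    by (rule comm_monoidI) auto
qed (auto simp: algebra_simps)

locale complex_space = Module.module complex_alg V for V (structure)
begin

lemma scale_closed [simp, intro]: "x \<in> carrier V \<Longrightarrow> c \<odot> x \<in> carrier V"
  using smult_closed[of c x] by simp

lemma scale_add_left: "x \<in> carrier V \<Longrightarrow> (c + d) \<odot> x = c \<odot> x \<oplus> d \<odot> x"
  using smult_l_distr[of c d x] by simp

lemma scale_add_right:
  "x \<in> carrier V \<Longrightarrow> y \<in> carrier V \<Longrightarrow> c \<odot> (x \<oplus> y) = c \<odot> x \<oplus> c \<odot> y"
  using smult_r_distr[of c x y] by simp

lemma scale_scale: "x \<in> carrier V \<Longrightarrow> c \<odot> (d \<odot> x) = (c * d) \<odot> x"
  using smult_assoc1[of c d x] by simp

lemma scale_one [simp]: "x \<in> carrier V \<Longrightarrow> 1 \<odot> x = x"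
  using smult_one[of x] by simp

lemma scale_zero_left [simp]: "x \<in> carrier V \<Longrightarrow> 0 \<odot> x = \<zero>"
  using smult_l_null[of x] by simp

lemma scale_zero_right [simp]: "c \<odot> \<zero> = \<zero>"
  using smult_r_null[of c] by simp

lemma scale_minus_one: "x \<in> carrier V \<Longrightarrow> (- 1) \<odot> x = \<ominus> x"
  using scale_add_left[of x "- 1" 1] by (intro M.minus_equality[symmetric]) auto

lemma add_eq_zero_imp_eq:
  assumes "x \<in> carrier V" "y \<in> carrier V" "x \<oplus> (- 1) \<odot> y = \<zero>"
  shows "x = y"
  using assms scale_minus_one[of y] M.r_neg1 M.minus_equality M.minus_minus
  by (metis M.add.inv_closed)

end

lemma complex_spaceI:
  fixes V (structure)
  assumes "abelian_group V"
    and "\<And>c x. x \<in> carrier V \<Longrightarrow> c \<odot> x \<in> carrier V"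
    and "\<And>c d x. x \<in> carrier V \<Longrightarrow> (c + d) \<odot> x = c \<odot> x \<oplus> d \<odot> x"
    and "\<And>c x y. x \<in> carrier V \<Longrightarrow> y \<in> carrier V \<Longrightarrow> c \<odot> (x \<oplus> y) = c \<odot> x \<oplus> c \<odot> y"
    and "\<And>c d x. x \<in> carrier V \<Longrightarrow> (c * d) \<odot> x = c \<odot> (d \<odot> x)"
    and "\<And>x. x \<in> carrier V \<Longrightarrow> 1 \<odot> x = x"
  shows "complex_space V"
  unfolding complex_space_def
  by (rule moduleI[OF cring_complex_alg]) (use assms in auto)

sublocale complex_algebra \<subseteq> complex_space A
  by unfold_locales

lemma complex_algebraI:
  assumes "complex_space A" "ring A"
    and "\<And>c x y. x \<in> carrier A \<Longrightarrow> y \<in> carrier A \<Longrightarrow>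
      (c \<odot>\<^bsub>A\<^esub> x) \<otimes>\<^bsub>A\<^esub> y = c \<odot>\<^bsub>A\<^esub> (x \<otimes>\<^bsub>A\<^esub> y)"
    and "\<And>c x y. x \<in> carrier A \<Longrightarrow> y \<in> carrier A \<Longrightarrow>
      x \<otimes>\<^bsub>A\<^esub> (c \<odot>\<^bsub>A\<^esub> y) = c \<odot>\<^bsub>A\<^esub> (x \<otimes>\<^bsub>A\<^esub> y)"
  shows "complex_algebra A"
  unfolding complex_algebra_def complex_algebra_axioms_def
  using assms by (simp add: complex_space_def)

lemma complex_algebra_space: "complex_algebra A \<Longrightarrow> complex_space A"
  by (simp add: complex_algebra_def complex_space_def)

lemma complex_algebra_ring: "complex_algebra A \<Longrightarrow> ring A"
  by (simp add: complex_algebra_def)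

lemma complex_algebra_complex_alg: "complex_algebra complex_alg"
proof -
  interpret cring complex_alg by (rule cring_complex_alg)
  show ?thesis
    by (intro complex_algebraI complex_spaceI abelian_group_axioms ring_axioms)
      (auto simp: algebra_simps)
qed

lemma linear_mapD:
  assumes "linear_map V W f"
  shows "x \<in> carrier V \<Longrightarrow> f x \<in> carrier W"
    and "x \<in> carrier V \<Longrightarrow> y \<in> carrier V \<Longrightarrow> f (x \<oplus>\<^bsub>V\<^esub> y) = f x \<oplus>\<^bsub>W\<^esub> f y"
    and "x \<in> carrier V \<Longrightarrow> f (c \<odot>\<^bsub>V\<^esub> x) = c \<odot>\<^bsub>W\<^esub> f x"
  using assms by (auto simp: linear_map_def)

lemma linear_mapI:
  assumes "\<And>x. x \<in> carrier V \<Longrightarrow> f x \<in> carrier W"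
    and "\<And>x y. x \<in> carrier V \<Longrightarrow> y \<in> carrier V \<Longrightarrow> f (x \<oplus>\<^bsub>V\<^esub> y) = f x \<oplus>\<^bsub>W\<^esub> f y"
    and "\<And>c x. x \<in> carrier V \<Longrightarrow> f (c \<odot>\<^bsub>V\<^esub> x) = c \<odot>\<^bsub>W\<^esub> f x"
  shows "linear_map V W f"
  using assms by (auto simp: linear_map_def)

lemma linear_map_compose:
  assumes "linear_map U V f" "linear_map V W g"
  shows "linear_map U W (\<lambda>x. g (f x))"
  by (rule linear_mapI) (simp_all add: linear_mapD[OF assms(1)] linear_mapD[OF assms(2)])

lemma algebra_homD:
  assumes "algebra_hom A B f"
  shows "x \<in> carrier A \<Longrightarrow> f x \<in> carrier B"
    and "x \<in> carrier A \<Longrightarrow> y \<in> carrier A \<Longrightarrow> f (x \<oplus>\<^bsub>A\<^esub> y) = f x \<oplus>\<^bsub>B\<^esub> f y"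
    and "x \<in> carrier A \<Longrightarrow> f (c \<odot>\<^bsub>A\<^esub> x) = c \<odot>\<^bsub>B\<^esub> f x"
    and "x \<in> carrier A \<Longrightarrow> y \<in> carrier A \<Longrightarrow> f (x \<otimes>\<^bsub>A\<^esub> y) = f x \<otimes>\<^bsub>B\<^esub> f y"
    and "f \<one>\<^bsub>A\<^esub> = \<one>\<^bsub>B\<^esub>"
    and "linear_map A B f"
  using assms by (auto simp: algebra_hom_def linear_map_def ring_hom_def)

lemma algebra_homI:
  assumes "linear_map A B f"
    and "\<And>x y. x \<in> carrier A \<Longrightarrow> y \<in> carrier A \<Longrightarrow> f (x \<otimes>\<^bsub>A\<^esub> y) = f x \<otimes>\<^bsub>B\<^esub> f y"
    and "f \<one>\<^bsub>A\<^esub> = \<one>\<^bsub>B\<^esub>"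
  shows "algebra_hom A B f"
  using assms by (auto simp: algebra_hom_def linear_map_def ring_hom_def)

lemma algebra_hom_compose:
  assumes "algebra_hom A B f" "algebra_hom B C g"
  shows "algebra_hom A C (\<lambda>x. g (f x))"
  by (intro algebra_homI linear_map_compose[OF algebra_homD(6)[OF assms(1)] algebra_homD(6)[OF assms(2)]])
    (simp_all add: algebra_homD[OF assms(1)] algebra_homD[OF assms(2)])

lemma algebra_hom_id: "algebra_hom A A id"
  by (auto intro!: algebra_homI linear_mapI)

lemma algebra_hom_restrict:
  assumes "complex_algebra A" "algebra_hom A B f"
  shows "algebra_hom A B (restrict f (carrier A))"
proof -
  interpret complex_algebra A by fact
  show ?thesis
    by (intro algebra_homI linear_mapI) (simp_all add: algebra_homD[OF assms(2)])
qed

text \<open>The opposite algebra: an antihomomorphism is a homomorphism into it.\<close>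

definition opposite_algebra :: "(complex, 'a) module \<Rightarrow> (complex, 'a) module" where
  "opposite_algebra A = A\<lparr>mult := \<lambda>x y. y \<otimes>\<^bsub>A\<^esub> x\<rparr>"

lemma opposite_algebra_simps [simp]:
  "carrier (opposite_algebra A) = carrier A" "one (opposite_algebra A) = one A"
  "zero (opposite_algebra A) = zero A" "add (opposite_algebra A) = add A"
  "smult (opposite_algebra A) = smult A" "mult (opposite_algebra A) x y = y \<otimes>\<^bsub>A\<^esub> x"
  by (simp_all add: opposite_algebra_def)

lemma algebra_antihom_iff: "algebra_antihom A B f \<longleftrightarrow> algebra_hom A (opposite_algebra B) f"
  by (simp add: algebra_antihom_def opposite_algebra_def)

lemma complex_algebra_opposite:
  assumes "complex_algebra A"
  shows "complex_algebra (opposite_algebra A)"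
proof -
  interpret complex_algebra A by fact
  have ab: "abelian_group (opposite_algebra A)"
    by (rule abelian_groupI) (simp_all add: M.a_ac M.add.l_inv_ex)
  show ?thesis
  proof (rule complex_algebraI)
    show "complex_space (opposite_algebra A)"
      by (rule complex_spaceI[OF ab])
        (simp_all add: scale_add_left scale_add_right scale_scale)
    show "ring (opposite_algebra A)"
      by (rule ringI[OF ab monoidI]) (simp_all add: m_assoc l_distr r_distr)
  qed (simp_all add: smult_mult_left smult_mult_right)
qed

section \<open>Formal linear combinations and the monoid algebra\<close>

text \<open>
  The linear extension of a map given on a basis. The formula is the one inside \<open>tensor_lift\<close>, so
  presentations and tensor products can use the same facts about it.
\<close>
definition lin_ext :: "(complex, 'v, 'e) module_scheme \<Rightarrow> ('k \<Rightarrow> 'v) \<Rightarrow> ('k \<Rightarrow>\<^sub>0 complex) \<Rightarrow> 'v" where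
  "lin_ext V \<phi> F = finsum V (\<lambda>p. Poly_Mapping.lookup F p \<odot>\<^bsub>V\<^esub> \<phi> p) (Poly_Mapping.keys F)"

lemma lookup_scale_pm [simp]:
  "Poly_Mapping.lookup (scale_pm c F) k = c * Poly_Mapping.lookup F k"
  by (simp add: Poly_Mapping.map.rep_eq when_def)

lemma keys_scale_pm: "Poly_Mapping.keys (scale_pm c F) \<subseteq> Poly_Mapping.keys F"
  by (auto simp: in_keys_iff)

lemma scale_pm_single [simp]:
  "scale_pm c (Poly_Mapping.single k d) = Poly_Mapping.single k (c * d)"
  by (rule poly_mapping_eqI) (simp add: lookup_single when_def)

lemma scale_pm_zero [simp]: "scale_pm c 0 = 0"
  by (rule poly_mapping_eqI) simp

lemma scale_pm_add: "scale_pm c (f + g) = scale_pm c f + scale_pm c g"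
  by (rule poly_mapping_eqI) (simp add: lookup_add algebra_simps)

lemma scale_pm_diff: "scale_pm c (f - g) = scale_pm c f - scale_pm c g"
  by (rule poly_mapping_eqI) (simp add: lookup_minus algebra_simps)

lemma keys_add_subset:
  "Poly_Mapping.keys f \<subseteq> K \<Longrightarrow> Poly_Mapping.keys g \<subseteq> K \<Longrightarrow> Poly_Mapping.keys (f + g) \<subseteq> K"
  using Poly_Mapping.keys_add[of f g] by blast

lemma poly_mapping_keys_induct [consumes 1, case_names zero single add]:
  fixes F :: "'k \<Rightarrow>\<^sub>0 complex"
  assumes "Poly_Mapping.keys F \<subseteq> K"
    and zero: "P 0"
    and single: "\<And>k c. k \<in> K \<Longrightarrow> P (Poly_Mapping.single k c)"
    and add: "\<And>F G. Poly_Mapping.keys F \<subseteq> K \<Longrightarrow> Poly_Mapping.keys G \<subseteq> K \<Longrightarrow> P F \<Longrightarrow> P G \<Longrightarrow> P (F + G)"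
  shows "P F"
proof -
  have "P (\<Sum>k\<in>S. Poly_Mapping.single k (Poly_Mapping.lookup F k))" if "finite S" "S \<subseteq> K" for S
    using that
  proof (induction S rule: finite_induct)
    case (insert k S)
    have "Poly_Mapping.keys (\<Sum>k\<in>S. Poly_Mapping.single k (Poly_Mapping.lookup F k)) \<subseteq> K"
      using insert.prems by (intro order_trans[OF keys_sum] UN_least) auto
    thus ?case using insert by (auto intro!: add single split: if_split_asm)
  qed (use zero in simp)
  moreover have "(\<Sum>k\<in>Poly_Mapping.keys F. Poly_Mapping.single k (Poly_Mapping.lookup F k)) = F"
    by (rule poly_mapping_eqI) (simp add: lookup_sum lookup_single when_def in_keys_iff)
  ultimately show ?thesis using assms(1) finite_keys[of F] by metis
qed

context complex_space
begin

text \<open>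
  The terms outside the support vanish, so combinations with different supports can be compared as
  sums over a common index set.
\<close>
lemma lin_ext_superset:
  assumes "\<phi> \<in> K \<rightarrow> carrier V" "finite S" "Poly_Mapping.keys F \<subseteq> S" "S \<subseteq> K"
  shows "lin_ext V \<phi> F = finsum V (\<lambda>p. Poly_Mapping.lookup F p \<odot> \<phi> p) S"
  unfolding lin_ext_def
  by (rule M.add.finprod_mono_neutral_cong_left)
    (use assms in \<open>auto simp: in_keys_iff Pi_iff subset_iff intro!: scale_closed\<close>)

lemma lin_ext_closed:
  assumes "\<phi> \<in> K \<rightarrow> carrier V" "Poly_Mapping.keys F \<subseteq> K"
  shows "lin_ext V \<phi> F \<in> carrier V"
  unfolding lin_ext_def by (rule M.finsum_closed) (use assms in auto)

lemma lin_ext_add: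
  assumes "\<phi> \<in> K \<rightarrow> carrier V" "Poly_Mapping.keys F \<subseteq> K" "Poly_Mapping.keys G \<subseteq> K"
  shows "lin_ext V \<phi> (F + G) = lin_ext V \<phi> F \<oplus> lin_ext V \<phi> G"
proof -
  let ?S = "Poly_Mapping.keys F \<union> Poly_Mapping.keys G"
  have car: "\<And>p. p \<in> ?S \<Longrightarrow> \<phi> p \<in> carrier V" using assms by auto
  have "Poly_Mapping.keys (F + G) \<subseteq> ?S"
    by (rule keys_add_subset) auto
  hence "lin_ext V \<phi> (F + G)
      = finsum V (\<lambda>p. Poly_Mapping.lookup F p \<odot> \<phi> p \<oplus> Poly_Mapping.lookup G p \<odot> \<phi> p) ?S"
    using assms car
    by (subst lin_ext_superset[of \<phi> K ?S])
      (simp_all add: lookup_add scale_add_left cong: M.add.finprod_cong)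
  also have "\<dots> = lin_ext V \<phi> F \<oplus> lin_ext V \<phi> G"
    using assms car
    by (simp add: lin_ext_superset[of \<phi> K ?S] M.finsum_addf Pi_iff)
  finally show ?thesis .
qed

lemma lin_ext_zero [simp]: "lin_ext V \<phi> 0 = \<zero>"
  by (simp add: lin_ext_def)

lemma lin_ext_single:
  assumes "\<phi> k \<in> carrier V"
  shows "lin_ext V \<phi> (Poly_Mapping.single k c) = c \<odot> \<phi> k"
  using assms by (cases "c = 0") (simp_all add: lin_ext_def M.finsum_insert)

lemma lin_ext_scale:
  assumes "\<phi> \<in> K \<rightarrow> carrier V" "Poly_Mapping.keys F \<subseteq> K"
  shows "lin_ext V \<phi> (scale_pm c F) = c \<odot> lin_ext V \<phi> F"
  using assms(2)
proof (induction F rule: poly_mapping_keys_induct)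
  case zero
  show ?case by simp
next
  case (single k d)
  then show ?case using assms by (simp add: lin_ext_single Pi_iff scale_scale)
next
  case (add F G)
  thus ?case
    using keys_scale_pm[of c F] keys_scale_pm[of c G]
    by (simp add: scale_pm_add lin_ext_add[OF assms(1)] lin_ext_closed[OF assms(1)] scale_add_right subset_trans)
qed

text \<open>
  Relators are differences. This reduces killing a relator to comparing the values of its two sides.
\<close>
lemma lin_ext_diff_eq_zero:
  assumes \<phi>: "\<phi> \<in> K \<rightarrow> carrier V"
    and f: "Poly_Mapping.keys f \<subseteq> K" and g: "Poly_Mapping.keys g \<subseteq> K"
    and eq: "lin_ext V \<phi> f = lin_ext V \<phi> g"
  shows "lin_ext V \<phi> (f - g) = \<zero>"
proof -
  have "Poly_Mapping.keys (scale_pm (- 1) g) \<subseteq> K"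
    using keys_scale_pm g by (rule order_trans)
  hence "lin_ext V \<phi> (f + scale_pm (- 1) g) = lin_ext V \<phi> f \<oplus> lin_ext V \<phi> (scale_pm (- 1) g)"
    by (rule lin_ext_add[OF \<phi> f])
  moreover have "lin_ext V \<phi> (scale_pm (- 1) g) = \<ominus> lin_ext V \<phi> g"
    by (subst lin_ext_scale[OF \<phi> g]) (rule scale_minus_one[OF lin_ext_closed[OF \<phi> g]])
  moreover have "f - g = f + scale_pm (- 1) g"
    by (rule poly_mapping_eqI) (simp add: lookup_add lookup_minus)
  ultimately show ?thesis
    using eq M.r_neg[OF lin_ext_closed[OF \<phi> g]] by metis
qed

end

lemma monoid_algebra_simps [simp]:
  "carrier (monoid_algebra G) = {f. Poly_Mapping.keys f \<subseteq> carrier G}"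
  "one (monoid_algebra G) = Poly_Mapping.single \<one>\<^bsub>G\<^esub> 1"
  "zero (monoid_algebra G) = 0" "add (monoid_algebra G) = (+)"
  "smult (monoid_algebra G) = scale_pm"
  by (simp_all add: monoid_algebra_def)

lemma linear_map_lin_ext:
  assumes "complex_space V" and \<phi>: "\<phi> \<in> carrier G \<rightarrow> carrier V"
  shows "linear_map (monoid_algebra G) V (lin_ext V \<phi>)"
proof -
  interpret complex_space V by fact
  show ?thesis
    by (intro linear_mapI)
      (auto simp: lin_ext_closed[OF \<phi>] lin_ext_add[OF \<phi>] lin_ext_scale[OF \<phi>])
qed

lemma monoid_algebra_mult_add_left:
  "(f + f') \<otimes>\<^bsub>monoid_algebra G\<^esub> g = f \<otimes>\<^bsub>monoid_algebra G\<^esub> g + f' \<otimes>\<^bsub>monoid_algebra G\<^esub> g"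
  unfolding monoid_algebra_def
  using setsum_keys_plus_distrib[of
      "\<lambda>a c. \<Sum>b\<in>Poly_Mapping.keys g. Poly_Mapping.single (a \<otimes>\<^bsub>G\<^esub> b) (c * Poly_Mapping.lookup g b)" f f']
  by (simp add: distrib_right sum.distrib Poly_Mapping.single_add)

lemma monoid_algebra_mult_add_right:
  "f \<otimes>\<^bsub>monoid_algebra G\<^esub> (g + g') = f \<otimes>\<^bsub>monoid_algebra G\<^esub> g + f \<otimes>\<^bsub>monoid_algebra G\<^esub> g'"
proof -
  have "(\<Sum>b\<in>Poly_Mapping.keys (g + g'). Poly_Mapping.single (a \<otimes>\<^bsub>G\<^esub> b) (c * Poly_Mapping.lookup (g + g') b))
      = (\<Sum>b\<in>Poly_Mapping.keys g. Poly_Mapping.single (a \<otimes>\<^bsub>G\<^esub> b) (c * Poly_Mapping.lookup g b))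
      + (\<Sum>b\<in>Poly_Mapping.keys g'. Poly_Mapping.single (a \<otimes>\<^bsub>G\<^esub> b) (c * Poly_Mapping.lookup g' b))" for a c
    by (rule setsum_keys_plus_distrib) (simp_all add: distrib_left Poly_Mapping.single_add)
  thus ?thesis
    by (simp add: monoid_algebra_def sum.distrib)
qed

lemma monoid_algebra_mult_zero [simp]:
  "0 \<otimes>\<^bsub>monoid_algebra G\<^esub> g = 0" "f \<otimes>\<^bsub>monoid_algebra G\<^esub> 0 = 0"
  by (simp_all add: monoid_algebra_def)

lemma monoid_algebra_mult_single [simp]:
  "Poly_Mapping.single a c \<otimes>\<^bsub>monoid_algebra G\<^esub> Poly_Mapping.single b d
     = Poly_Mapping.single (a \<otimes>\<^bsub>G\<^esub> b) (c * d)"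
  by (simp add: monoid_algebra_def)

lemma monoid_algebra_mult_diff:
  "(f - f') \<otimes>\<^bsub>monoid_algebra G\<^esub> g = f \<otimes>\<^bsub>monoid_algebra G\<^esub> g - f' \<otimes>\<^bsub>monoid_algebra G\<^esub> g"
  "f \<otimes>\<^bsub>monoid_algebra G\<^esub> (g - g') = f \<otimes>\<^bsub>monoid_algebra G\<^esub> g - f \<otimes>\<^bsub>monoid_algebra G\<^esub> g'"
  using monoid_algebra_mult_add_left[where f = "f - f'" and f' = f' and G = G and g = g, symmetric]
    monoid_algebra_mult_add_right[where f = f and G = G and g = "g - g'" and g' = g', symmetric]
  by (simp_all add: eq_diff_eq)

text \<open>
  The type of \<open>G\<close> has no further record fields, as \<open>monoid_algebra\<close> requires.
\<close>
locale basis_monoid = Group.monoid G for G :: "'m monoid" (structure)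
begin

lemma monoid_algebra_mult_closed:
  assumes "Poly_Mapping.keys f \<subseteq> carrier G" "Poly_Mapping.keys g \<subseteq> carrier G"
  shows "Poly_Mapping.keys (f \<otimes>\<^bsub>monoid_algebra G\<^esub> g) \<subseteq> carrier G"
  using assms(1)
proof (induction f rule: poly_mapping_keys_induct)
  case (single a c)
  show ?case using assms(2)
  proof (induction g rule: poly_mapping_keys_induct)
    case (add f' g')
    thus ?case by (simp add: monoid_algebra_mult_add_right keys_add_subset)
  qed (use single in auto)
next
  case (add f f')
  thus ?case by (simp add: monoid_algebra_mult_add_left keys_add_subset)
qed simp

text \<open>
  Both sides are linear in each of the three arguments, so associativity is inherited from the
  basis.
\<close>
lemma monoid_algebra_assoc:
  assumes "Poly_Mapping.keys f \<subseteq> carrier G" "Poly_Mapping.keys g \<subseteq> carrier G"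
    "Poly_Mapping.keys h \<subseteq> carrier G"
  shows "(f \<otimes>\<^bsub>monoid_algebra G\<^esub> g) \<otimes>\<^bsub>monoid_algebra G\<^esub> h
    = f \<otimes>\<^bsub>monoid_algebra G\<^esub> (g \<otimes>\<^bsub>monoid_algebra G\<^esub> h)"
  using assms(1)
proof (induction f rule: poly_mapping_keys_induct)
  case (single a c)
  show ?case using assms(2)
  proof (induction g rule: poly_mapping_keys_induct)
    case (single b d)
    show ?case using assms(3)
      by (induction h rule: poly_mapping_keys_induct)
        (use single \<open>a \<in> carrier G\<close> in \<open>auto simp: m_assoc mult.assoc monoid_algebra_mult_add_right\<close>)
  qed (simp_all add: monoid_algebra_mult_add_left monoid_algebra_mult_add_right)
qed (simp_all add: monoid_algebra_mult_add_left)

lemma monoid_algebra_one: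
  assumes "Poly_Mapping.keys f \<subseteq> carrier G"
  shows "Poly_Mapping.single \<one> 1 \<otimes>\<^bsub>monoid_algebra G\<^esub> f = f"
    and "f \<otimes>\<^bsub>monoid_algebra G\<^esub> Poly_Mapping.single \<one> 1 = f"
  using assms
  by (induction f rule: poly_mapping_keys_induct)
    (auto simp: monoid_algebra_mult_add_left monoid_algebra_mult_add_right)

lemma monoid_algebra_scale:
  assumes "Poly_Mapping.keys f \<subseteq> carrier G" "Poly_Mapping.keys g \<subseteq> carrier G"
  shows "scale_pm c f \<otimes>\<^bsub>monoid_algebra G\<^esub> g = scale_pm c (f \<otimes>\<^bsub>monoid_algebra G\<^esub> g)"
    and "f \<otimes>\<^bsub>monoid_algebra G\<^esub> scale_pm c g = scale_pm c (f \<otimes>\<^bsub>monoid_algebra G\<^esub> g)"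
proof -
  have "scale_pm c f \<otimes>\<^bsub>monoid_algebra G\<^esub> g = scale_pm c (f \<otimes>\<^bsub>monoid_algebra G\<^esub> g)
    \<and> f \<otimes>\<^bsub>monoid_algebra G\<^esub> scale_pm c g = scale_pm c (f \<otimes>\<^bsub>monoid_algebra G\<^esub> g)"
    using assms(1)
  proof (induction f rule: poly_mapping_keys_induct)
    case (single a d)
    show ?case using assms(2)
      by (induction g rule: poly_mapping_keys_induct)
        (simp_all add: monoid_algebra_mult_add_right scale_pm_add mult.assoc mult.left_commute[of d])
  qed (simp_all add: monoid_algebra_mult_add_left scale_pm_add)
  thus "scale_pm c f \<otimes>\<^bsub>monoid_algebra G\<^esub> g = scale_pm c (f \<otimes>\<^bsub>monoid_algebra G\<^esub> g)"
    "f \<otimes>\<^bsub>monoid_algebra G\<^esub> scale_pm c g = scale_pm c (f \<otimes>\<^bsub>monoid_algebra G\<^esub> g)"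
    by blast+
qed

lemma complex_algebra_monoid_algebra: "complex_algebra (monoid_algebra G)"
proof -
  have ab: "abelian_group (monoid_algebra G)"
  proof (rule abelian_groupI)
    fix f assume "f \<in> carrier (monoid_algebra G)"
    thus "\<exists>g\<in>carrier (monoid_algebra G). g \<oplus>\<^bsub>monoid_algebra G\<^esub> f = \<zero>\<^bsub>monoid_algebra G\<^esub>"
      by (intro bexI[of _ "- f"]) auto
  qed (simp_all add: add_ac keys_add_subset)
  show ?thesis
  proof (rule complex_algebraI)
    show "complex_space (monoid_algebra G)"
    proof (rule complex_spaceI[OF ab])
      fix c f assume "f \<in> carrier (monoid_algebra G)"
      thus "c \<odot>\<^bsub>monoid_algebra G\<^esub> f \<in> carrier (monoid_algebra G)"
        using keys_scale_pm[of c f] by auto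
    qed (simp_all add: scale_pm_add poly_mapping_eq_iff fun_eq_iff lookup_add algebra_simps)
    show "ring (monoid_algebra G)"
      by (rule ringI[OF ab monoidI])
        (simp_all add: monoid_algebra_mult_closed monoid_algebra_assoc monoid_algebra_one
          monoid_algebra_mult_add_left monoid_algebra_mult_add_right)
  qed (simp_all add: monoid_algebra_scale)
qed

text \<open>Multiplicativity of the extension is an identity that is linear in both factors, so it is
  inherited from the basis.\<close>

lemma algebra_hom_lin_ext:
  assumes B: "complex_algebra B"
    and \<phi>: "\<phi> \<in> carrier G \<rightarrow> carrier B"
    and mult: "\<And>x y. x \<in> carrier G \<Longrightarrow> y \<in> carrier G \<Longrightarrow> \<phi> (x \<otimes> y) = \<phi> x \<otimes>\<^bsub>B\<^esub> \<phi> y"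
    and one: "\<phi> \<one> = \<one>\<^bsub>B\<^esub>"
  shows "algebra_hom (monoid_algebra G) B (lin_ext B \<phi>)"
proof (rule algebra_homI)
  interpret B: complex_algebra B by fact
  show "linear_map (monoid_algebra G) B (lin_ext B \<phi>)"
    by (rule linear_map_lin_ext[OF complex_algebra_space[OF B] \<phi>])
  show "lin_ext B \<phi> \<one>\<^bsub>monoid_algebra G\<^esub> = \<one>\<^bsub>B\<^esub>"
    by (simp add: B.lin_ext_single one)
  fix f g assume fg: "f \<in> carrier (monoid_algebra G)" "g \<in> carrier (monoid_algebra G)"
  note [simp] = B.lin_ext_add[OF \<phi>] B.lin_ext_closed[OF \<phi>] monoid_algebra_mult_closed
    monoid_algebra_mult_add_left monoid_algebra_mult_add_right
  have \<phi>': "\<phi> x \<in> carrier B" if "x \<in> carrier G" for x using \<phi> that by auto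
  from fg(1) have "Poly_Mapping.keys f \<subseteq> carrier G" by simp
  thus "lin_ext B \<phi> (f \<otimes>\<^bsub>monoid_algebra G\<^esub> g) = lin_ext B \<phi> f \<otimes>\<^bsub>B\<^esub> lin_ext B \<phi> g"
  proof (induction f rule: poly_mapping_keys_induct)
    case (single a c)
    from fg(2) have "Poly_Mapping.keys g \<subseteq> carrier G" by simp
    thus ?case
      by (induction g rule: poly_mapping_keys_induct)
        (use single in \<open>simp_all add: B.lin_ext_single \<phi>' mult B.smult_mult_left
          B.smult_mult_right B.scale_scale mult.commute[of c] B.r_distr\<close>)
  qed (use fg in \<open>simp_all add: B.l_distr\<close>)
qed

end

section \<open>Quotient algebras and algebras given by generators and relations\<close>

locale algebra_quotient = complex_algebra A + ideal I A
  for A :: "(complex, 'a) module" (structure) and I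
begin

lemma quot_algebra_simps [simp]:
  "one (quot_algebra A I) = I +> \<one>" "zero (quot_algebra A I) = I"
  "add (quot_algebra A I) = set_add A" "mult (quot_algebra A I) = rcoset_mult A I"
  "carrier (quot_algebra A I) = a_rcosets I"
  by (simp_all add: quot_algebra_def FactRing_def)

lemma coset_carrier [simp]: "x \<in> carrier A \<Longrightarrow> I +> x \<in> a_rcosets I"
  by (rule a_rcosetsI[OF a_subset])

lemma cosetE:
  assumes "Z \<in> a_rcosets I"
  obtains x where "x \<in> carrier A" "Z = I +> x"
  using assms by (auto simp: A_RCOSETS_defs a_r_coset_def)

lemma coset_memE:
  assumes "y \<in> I +> x"
  obtains h where "h \<in> I" "y = h \<oplus> x"
  using assms by (auto simp: a_r_coset_def r_coset_def)

lemma coset_eqI: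
  assumes "x \<in> carrier A" "h \<in> I"
  shows "I +> (h \<oplus> x) = I +> x"
  using assms by (intro a_repr_independence'[symmetric]) (auto simp: a_r_coset_def r_coset_def)

text \<open>
  Ideals of a unital algebra are subspaces because scaling is multiplication by \<open>c \<odot> \<one>\<close>.
\<close>
lemma scale_ideal:
  assumes "h \<in> I"
  shows "c \<odot> h \<in> I"
proof -
  have "(c \<odot> \<one>) \<otimes> h \<in> I" using assms by (intro I_l_closed) auto
  thus ?thesis using assms by (simp add: smult_mult_left)
qed

lemma smult_coset:
  assumes "x \<in> carrier A"
  shows "c \<odot>\<^bsub>quot_algebra A I\<^esub> (I +> x) = I +> (c \<odot> x)"
proof -
  have "I +> (c \<odot> y) = I +> (c \<odot> x)" if "y \<in> I +> x" for y
  proof -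
    from that obtain h where h: "h \<in> I" "y = h \<oplus> x" by (rule coset_memE)
    thus ?thesis using assms
      by (simp add: scale_add_right coset_eqI scale_ideal)
  qed
  moreover have "x \<in> I +> x" using assms by (rule a_rcos_self)
  ultimately have "(\<Union>y\<in>I +> x. I +> (c \<odot> y)) = I +> (c \<odot> x)" by blast
  thus ?thesis by (simp add: quot_algebra_def)
qed

lemma complex_algebra_quot: "complex_algebra (quot_algebra A I)"
proof -
  interpret Q: ring "A Quot I" by (rule quotient_is_ring)
  note [simp] = rcoset_mult_add a_rcos_sum smult_coset
  have ab: "abelian_group (quot_algebra A I)"
    by (rule abelian_groupI)
      (use Q.add.l_inv_ex Q.zero_closed Q.a_assoc Q.a_comm Q.add.m_closed Q.l_zero in
        \<open>simp_all add: FactRing_def\<close>)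
  show ?thesis
  proof (rule complex_algebraI)
    show "complex_space (quot_algebra A I)"
      by (rule complex_spaceI[OF ab])
        (auto elim!: cosetE simp: scale_add_left scale_add_right scale_scale)
    show "ring (quot_algebra A I)"
      by (rule ringI[OF ab monoidI]) (auto elim!: cosetE simp: m_assoc l_distr r_distr)
  qed (auto elim!: cosetE simp: smult_mult_left smult_mult_right)
qed

lemma algebra_hom_coset: "algebra_hom A (quot_algebra A I) (\<lambda>x. I +> x)"
  by (intro algebra_homI linear_mapI) (simp_all add: rcoset_mult_add a_rcos_sum smult_coset)

context
  fixes V :: "(complex, 'v) module" and h
  assumes V: "complex_space V" and h: "linear_map A V h"
    and kernel: "\<And>x. x \<in> I \<Longrightarrow> h x = \<zero>\<^bsub>V\<^esub>"
begin

text \<open>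
  A map that kills \<open>I\<close> is constant on each coset, so its image of a coset is a singleton.
\<close>
lemma factor_coset:
  assumes "x \<in> carrier A"
  shows "the_elem (h ` (I +> x)) = h x"
proof -
  interpret V: complex_space V by (rule V)
  have "h y = h x" if "y \<in> I +> x" for y
  proof -
    from that obtain i where i: "i \<in> I" "y = i \<oplus> x" by (rule coset_memE)
    hence "h y = \<zero>\<^bsub>V\<^esub> \<oplus>\<^bsub>V\<^esub> h x"
      using assms by (simp add: linear_mapD(2)[OF h] kernel)
    thus ?thesis using assms by (simp add: linear_mapD(1)[OF h])
  qed
  moreover have "x \<in> I +> x" using assms by (rule a_rcos_self)
  ultimately have "h ` (I +> x) = {h x}" by blast
  thus ?thesis by simp
qed

lemma linear_map_factor: "linear_map (quot_algebra A I) V (\<lambda>Z. the_elem (h ` Z))"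
proof (rule linear_mapI)
  fix Y Z c assume "Y \<in> carrier (quot_algebra A I)" "Z \<in> carrier (quot_algebra A I)"
  then obtain y z where yz: "y \<in> carrier A" "Y = I +> y" "z \<in> carrier A" "Z = I +> z"
    by (auto elim!: cosetE)
  thus "the_elem (h ` (Y \<oplus>\<^bsub>quot_algebra A I\<^esub> Z)) = the_elem (h ` Y) \<oplus>\<^bsub>V\<^esub> the_elem (h ` Z)"
    by (simp add: a_rcos_sum factor_coset linear_mapD(2)[OF h])
next
  fix Z c assume "Z \<in> carrier (quot_algebra A I)"
  then obtain z where z: "z \<in> carrier A" "Z = I +> z" by (auto elim!: cosetE)
  thus "the_elem (h ` Z) \<in> carrier V"
    and "the_elem (h ` (c \<odot>\<^bsub>quot_algebra A I\<^esub> Z)) = c \<odot>\<^bsub>V\<^esub> the_elem (h ` Z)"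
    by (simp_all add: smult_coset factor_coset linear_mapD[OF h])
qed

end

lemma algebra_hom_factor:
  assumes B: "complex_algebra B" and h: "algebra_hom A B h"
    and kernel: "\<And>x. x \<in> I \<Longrightarrow> h x = \<zero>\<^bsub>B\<^esub>"
  shows "algebra_hom (quot_algebra A I) B (\<lambda>Z. the_elem (h ` Z))"
proof -
  note factor = factor_coset[OF complex_algebra_space[OF B] algebra_homD(6)[OF h] kernel]
  show ?thesis
  proof (rule algebra_homI)
    show "linear_map (quot_algebra A I) B (\<lambda>Z. the_elem (h ` Z))"
      using complex_algebra_space[OF B] algebra_homD(6)[OF h] kernel by (rule linear_map_factor)
    fix Y Z assume "Y \<in> carrier (quot_algebra A I)" "Z \<in> carrier (quot_algebra A I)"
    then obtain y z where yz: "y \<in> carrier A" "Y = I +> y" "z \<in> carrier A" "Z = I +> z"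
      by (auto elim!: cosetE)
    thus "the_elem (h ` (Y \<otimes>\<^bsub>quot_algebra A I\<^esub> Z)) = the_elem (h ` Y) \<otimes>\<^bsub>B\<^esub> the_elem (h ` Z)"
      by (simp add: rcoset_mult_add factor algebra_homD(4)[OF h])
  qed (simp add: factor algebra_homD(5)[OF h])
qed

end

lemma basis_monoid_words: "basis_monoid \<lparr>carrier = lists L, mult = (@), one = []\<rparr>"
  unfolding basis_monoid_def by (rule monoidI) auto

lemma carrier_free_algebra [simp]:
  "carrier (free_algebra L) = {f. Poly_Mapping.keys f \<subseteq> lists L}"
  by (simp add: free_algebra_def)

lemma complex_algebra_free: "complex_algebra (free_algebra L)"
  unfolding free_algebra_def
  by (rule basis_monoid.complex_algebra_monoid_algebra[OF basis_monoid_words])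

definition eval_word :: "(complex, 'b) module \<Rightarrow> ('g \<Rightarrow> 'b) \<Rightarrow> 'g list \<Rightarrow> 'b" where
  "eval_word B \<phi> w = foldr (\<lambda>g b. \<phi> g \<otimes>\<^bsub>B\<^esub> b) w \<one>\<^bsub>B\<^esub>"

lemma eval_word_simps [simp]:
  "eval_word B \<phi> [] = \<one>\<^bsub>B\<^esub>" "eval_word B \<phi> (g # w) = \<phi> g \<otimes>\<^bsub>B\<^esub> eval_word B \<phi> w"
  by (simp_all add: eval_word_def)

lemma eval_word_closed:
  assumes "complex_algebra B" "\<phi> \<in> L \<rightarrow> carrier B" "w \<in> lists L"
  shows "eval_word B \<phi> w \<in> carrier B"
proof -
  interpret B: complex_algebra B by fact
  show ?thesis using assms(2,3) by (induction w) auto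
qed

lemma algebra_hom_eval:
  assumes B: "complex_algebra B" and \<phi>: "\<phi> \<in> L \<rightarrow> carrier B"
  shows "algebra_hom (free_algebra L) B (lin_ext B (eval_word B \<phi>))"
proof -
  interpret B: complex_algebra B by fact
  have app: "eval_word B \<phi> (v @ w) = eval_word B \<phi> v \<otimes>\<^bsub>B\<^esub> eval_word B \<phi> w"
    if "v \<in> lists L" "w \<in> lists L" for v w
    using that(1)
  proof (induction v)
    case (Cons g v)
    moreover from this have "\<phi> g \<in> carrier B" using \<phi> by auto
    ultimately show ?case
      using that(2) by (simp add: B.m_assoc eval_word_closed[OF B \<phi>])
  qed (use that in \<open>simp_all add: eval_word_closed[OF B \<phi>]\<close>)
  show ?thesis
    unfolding free_algebra_def
    by (rule basis_monoid.algebra_hom_lin_ext[OF basis_monoid_words B])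
      (use eval_word_closed[OF B \<phi>] app in auto)
qed

locale presentation =
  fixes L :: "'g set" and R :: "('g list \<Rightarrow>\<^sub>0 complex) set"
  assumes relators: "R \<subseteq> carrier (free_algebra L)"
begin

abbreviation "I \<equiv> genideal (free_algebra L) R"

abbreviation "P \<equiv> presented_algebra L R"

sublocale algebra_quotient "free_algebra L" I
proof -
  interpret F: complex_algebra "free_algebra L" by (rule complex_algebra_free)
  show "algebra_quotient (free_algebra L) I"
    by (intro algebra_quotient.intro F.complex_algebra_axioms F.genideal_ideal relators)
qed

lemma complex_algebra_presented: "complex_algebra P"
  unfolding presented_algebra_def by (rule complex_algebra_quot)

lemma presented_gen_closed: "g \<in> L \<Longrightarrow> presented_gen L R g \<in> carrier P"
  by (simp add: presented_algebra_def presented_gen_def)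

lemma algebra_hom_presented_coset: "algebra_hom (free_algebra L) P (\<lambda>f. I +>\<^bsub>free_algebra L\<^esub> f)"
  unfolding presented_algebra_def by (rule algebra_hom_coset)

lemma presented_relation: "r \<in> R \<Longrightarrow> I +>\<^bsub>free_algebra L\<^esub> r = \<zero>\<^bsub>P\<^esub>"
  using genideal_self[OF relators] a_rcos_const by (auto simp: presented_algebra_def)

text \<open>
  Projecting a monomial to the presented algebra multiplies its letters there.
\<close>
lemma coset_word:
  assumes "w \<in> lists L"
  shows "I +>\<^bsub>free_algebra L\<^esub> Poly_Mapping.single w c = c \<odot>\<^bsub>P\<^esub> eval_word P (presented_gen L R) w"
proof -
  interpret P: complex_algebra P by (rule complex_algebra_presented)
  note hom = algebra_homD[OF algebra_hom_presented_coset]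
  have 1: "I +>\<^bsub>free_algebra L\<^esub> Poly_Mapping.single w 1 = eval_word P (presented_gen L R) w"
    using assms
  proof (induction w)
    case Nil
    show ?case using hom(5) by (simp add: free_algebra_def)
  next
    case (Cons g w)
    have "Poly_Mapping.single (g # w) 1
        = Poly_Mapping.single [g] 1 \<otimes>\<^bsub>free_algebra L\<^esub> Poly_Mapping.single w (1::complex)"
      by (simp add: free_algebra_def)
    thus ?case using Cons by (simp add: hom(4) presented_gen_def)
  qed
  have "Poly_Mapping.single w c = c \<odot>\<^bsub>free_algebra L\<^esub> Poly_Mapping.single w 1"
    by (simp add: free_algebra_def)
  thus ?thesis using assms by (simp add: hom(3) 1)
qed

text \<open>
  Every element is a linear combination of words, and a word arises from \<open>1\<close> by left
  multiplication with generators.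
\<close>
lemma presented_induct [consumes 1, case_names one gen_mult add scale]:
  assumes "a \<in> carrier P"
    and one: "Q \<one>\<^bsub>P\<^esub>"
    and gen_mult: "\<And>g a. g \<in> L \<Longrightarrow> a \<in> carrier P \<Longrightarrow> Q a \<Longrightarrow> Q (presented_gen L R g \<otimes>\<^bsub>P\<^esub> a)"
    and add: "\<And>a b. a \<in> carrier P \<Longrightarrow> b \<in> carrier P \<Longrightarrow> Q a \<Longrightarrow> Q b \<Longrightarrow> Q (a \<oplus>\<^bsub>P\<^esub> b)"
    and scale: "\<And>c a. a \<in> carrier P \<Longrightarrow> Q a \<Longrightarrow> Q (c \<odot>\<^bsub>P\<^esub> a)"
  shows "Q a"
proof -
  interpret P: complex_algebra P by (rule complex_algebra_presented)
  note hom = algebra_homD[OF algebra_hom_presented_coset]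
  have gen: "presented_gen L R \<in> L \<rightarrow> carrier P" using presented_gen_closed by auto
  have word: "Q (eval_word P (presented_gen L R) w)" if "w \<in> lists L" for w
    using that by (induction w)
      (auto intro: one gen_mult eval_word_closed[OF complex_algebra_presented gen])
  have single: "Q (I +>\<^bsub>free_algebra L\<^esub> Poly_Mapping.single w c)" if "w \<in> lists L" for w c
    using that by (simp add: coset_word scale word eval_word_closed[OF complex_algebra_presented gen])
  from assms(1) obtain f where f: "Poly_Mapping.keys f \<subseteq> lists L" "a = I +>\<^bsub>free_algebra L\<^esub> f"
    unfolding presented_algebra_def by (auto elim!: cosetE)
  have "Q (I +>\<^bsub>free_algebra L\<^esub> f)" using f(1)
  proof (induction f rule: poly_mapping_keys_induct)
    case zero
    show ?case using single[of "[]" 0] by simp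
  next
    case (add f g)
    moreover have "I +>\<^bsub>free_algebra L\<^esub> (f + g)
        = (I +>\<^bsub>free_algebra L\<^esub> f) \<oplus>\<^bsub>P\<^esub> (I +>\<^bsub>free_algebra L\<^esub> g)"
      using hom(2)[of f g] add by (simp add: free_algebra_def)
    ultimately show ?case using hom(1) by (auto intro!: assms(4))
  qed (rule single)
  thus ?thesis by (simp add: f)
qed

lemma presented_hom_eqI:
  assumes B: "complex_algebra B" and "algebra_hom P B f" "algebra_hom P B g"
    and "\<And>x. x \<in> L \<Longrightarrow> f (presented_gen L R x) = g (presented_gen L R x)"
    and "a \<in> carrier P"
  shows "f a = g a"
  using assms(5)
  by (induction a rule: presented_induct)
    (simp_all add: algebra_homD[OF assms(2)] algebra_homD[OF assms(3)] assms(4) presented_gen_closed)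

text \<open>
  Evaluation on the free algebra has an ideal as its kernel. That ideal contains the
  relators, hence the ideal that they generate, and evaluation factors.
\<close>
lemma presented_lift:
  assumes B: "complex_algebra B" and \<phi>: "\<phi> \<in> L \<rightarrow> carrier B"
    and R: "\<And>r. r \<in> R \<Longrightarrow> lin_ext B (eval_word B \<phi>) r = \<zero>\<^bsub>B\<^esub>"
  shows "\<exists>h. algebra_hom P B h \<and> (\<forall>x\<in>L. h (presented_gen L R x) = \<phi> x)"
proof -
  interpret B: complex_algebra B by fact
  let ?h = "lin_ext B (eval_word B \<phi>)"
  note hom = algebra_hom_eval[OF B \<phi>]
  have "ring_hom_ring (free_algebra L) B ?h"
    using hom unfolding algebra_hom_def
    by (intro ring_hom_ringI2 complex_algebra_ring[OF complex_algebra_free] complex_algebra_ring[OF B]) blast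
  from ring_hom_ring.kernel_is_ideal[OF this]
  have "I \<subseteq> a_kernel (free_algebra L) B ?h"
  proof (rule genideal_minimal)
    show "R \<subseteq> a_kernel (free_algebra L) B ?h"
      using R relators unfolding a_kernel_def' by blast
  qed
  hence kernel: "?h f = \<zero>\<^bsub>B\<^esub>" if "f \<in> I" for f
    using that unfolding a_kernel_def' by blast
  have "the_elem (?h ` presented_gen L R x) = \<phi> x" if "x \<in> L" for x
  proof -
    have "\<phi> x \<in> carrier B" using \<phi> that by auto
    thus ?thesis
      using that factor_coset[OF complex_algebra_space[OF B] algebra_homD(6)[OF hom] kernel,
          of "Poly_Mapping.single [x] 1"]
      by (simp add: presented_gen_def B.lin_ext_single)
  qed
  with algebra_hom_factor[OF B hom kernel] show ?thesis
    unfolding presented_algebra_def by blast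
qed

end

section \<open>Tensor products\<close>

lemma module_scale_pm: "Modules.module scale_pm"
  unfolding Modules.module_def
  by (auto simp: poly_mapping_eq_iff fun_eq_iff lookup_add algebra_simps)

interpretation scale_pm: Modules.module scale_pm
  by (rule module_scale_pm)

lemma keys_diff_subset:
  fixes f g :: "'k \<Rightarrow>\<^sub>0 complex"
  shows "Poly_Mapping.keys f \<subseteq> K \<Longrightarrow> Poly_Mapping.keys g \<subseteq> K \<Longrightarrow> Poly_Mapping.keys (f - g) \<subseteq> K"
  using keys_add_subset[of f K "- g"] by simp

locale algebra_pair = A: complex_algebra A + B: complex_algebra B
  for A :: "(complex, 'a) module" and B :: "(complex, 'b) module"
begin

abbreviation "M \<equiv> monoid_algebra (A \<times>\<times> B)"

abbreviation "J \<equiv> bilinear_span A B"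

sublocale pair: basis_monoid "A \<times>\<times> B"
  unfolding basis_monoid_def
  by (rule DirProd_monoid) (rule A.monoid_axioms B.monoid_axioms)+

sublocale M: complex_algebra M
  by (rule pair.complex_algebra_monoid_algebra)

lemma relator_in_span:
  assumes "r \<in> bilinear_relators A B"
  shows "scale_pm c r \<in> J"
  unfolding bilinear_span_def by (intro scale_pm.span_scale scale_pm.span_base assms)

text \<open>
  The relators scaled by \<open>c\<close>, which is the form that they take when multiplied by a term with
  coefficient \<open>c\<close>.
\<close>
lemma bilinear_relation_in_span:
  "a \<in> carrier A \<Longrightarrow> a' \<in> carrier A \<Longrightarrow> b \<in> carrier B \<Longrightarrow>
    Poly_Mapping.single (a \<oplus>\<^bsub>A\<^esub> a', b) c - Poly_Mapping.single (a, b) c - Poly_Mapping.single (a', b) c \<in> J"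
  "a \<in> carrier A \<Longrightarrow> b \<in> carrier B \<Longrightarrow> b' \<in> carrier B \<Longrightarrow>
    Poly_Mapping.single (a, b \<oplus>\<^bsub>B\<^esub> b') c - Poly_Mapping.single (a, b) c - Poly_Mapping.single (a, b') c \<in> J"
  "a \<in> carrier A \<Longrightarrow> b \<in> carrier B \<Longrightarrow>
    Poly_Mapping.single (d \<odot>\<^bsub>A\<^esub> a, b) c - Poly_Mapping.single (a, b) (c * d) \<in> J"
  "a \<in> carrier A \<Longrightarrow> b \<in> carrier B \<Longrightarrow>
    Poly_Mapping.single (a, d \<odot>\<^bsub>B\<^esub> b) c - Poly_Mapping.single (a, b) (c * d) \<in> J"
proof -
  assume "a \<in> carrier A" "a' \<in> carrier A" "b \<in> carrier B"
  hence "Poly_Mapping.single (a \<oplus>\<^bsub>A\<^esub> a', b) 1 - Poly_Mapping.single (a, b) 1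
      - Poly_Mapping.single (a', b) 1 \<in> bilinear_relators A B"
    unfolding bilinear_relators_def by blast
  from relator_in_span[OF this, of c]
  show "Poly_Mapping.single (a \<oplus>\<^bsub>A\<^esub> a', b) c - Poly_Mapping.single (a, b) c
      - Poly_Mapping.single (a', b) c \<in> J"
    by (simp add: scale_pm_diff)
next
  assume "a \<in> carrier A" "b \<in> carrier B" "b' \<in> carrier B"
  hence "Poly_Mapping.single (a, b \<oplus>\<^bsub>B\<^esub> b') 1 - Poly_Mapping.single (a, b) 1
      - Poly_Mapping.single (a, b') 1 \<in> bilinear_relators A B"
    unfolding bilinear_relators_def by blast
  from relator_in_span[OF this, of c]
  show "Poly_Mapping.single (a, b \<oplus>\<^bsub>B\<^esub> b') c - Poly_Mapping.single (a, b) c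
      - Poly_Mapping.single (a, b') c \<in> J"
    by (simp add: scale_pm_diff)
next
  assume "a \<in> carrier A" "b \<in> carrier B"
  hence "Poly_Mapping.single (d \<odot>\<^bsub>A\<^esub> a, b) 1 - Poly_Mapping.single (a, b) d \<in> bilinear_relators A B"
    unfolding bilinear_relators_def by blast
  from relator_in_span[OF this, of c]
  show "Poly_Mapping.single (d \<odot>\<^bsub>A\<^esub> a, b) c - Poly_Mapping.single (a, b) (c * d) \<in> J"
    by (simp add: scale_pm_diff)
next
  assume "a \<in> carrier A" "b \<in> carrier B"
  hence "Poly_Mapping.single (a, d \<odot>\<^bsub>B\<^esub> b) 1 - Poly_Mapping.single (a, b) d \<in> bilinear_relators A B"
    unfolding bilinear_relators_def by blast
  from relator_in_span[OF this, of c]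
  show "Poly_Mapping.single (a, d \<odot>\<^bsub>B\<^esub> b) c - Poly_Mapping.single (a, b) (c * d) \<in> J"
    by (simp add: scale_pm_diff)
qed

lemma bilinear_relators_carrier: "r \<in> bilinear_relators A B \<Longrightarrow> r \<in> carrier M"
  unfolding bilinear_relators_def
  by (elim UnE CollectE exE conjE) (simp_all add: keys_diff_subset)

lemma bilinear_span_carrier:
  assumes "r \<in> J"
  shows "Poly_Mapping.keys r \<subseteq> carrier A \<times> carrier B"
  using assms unfolding bilinear_span_def
proof (induction r rule: scale_pm.span_induct)
  case base
  show ?case
    by (rule scale_pm.subspaceI)
      (simp_all add: keys_add_subset order_trans[OF keys_scale_pm])
next
  case (step r)
  thus ?case using bilinear_relators_carrier by simp
qed

text \<open>
  By distributivity in \<open>A\<close> and \<open>B\<close>, multiplying a relator by a pair gives a scaled relator of the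
  same kind; this is what makes the span an ideal and the product of the tensor product well defined.
\<close>
lemma single_mult_relator:
  assumes "a \<in> carrier A" "b \<in> carrier B" "r \<in> bilinear_relators A B"
  shows "Poly_Mapping.single (a, b) c \<otimes>\<^bsub>M\<^esub> r \<in> J" "r \<otimes>\<^bsub>M\<^esub> Poly_Mapping.single (a, b) c \<in> J"
  using assms unfolding bilinear_relators_def
  by (auto simp: monoid_algebra_mult_diff A.r_distr A.l_distr B.r_distr B.l_distr
      A.smult_mult_left A.smult_mult_right B.smult_mult_left B.smult_mult_right mult.commute[of _ c]
      intro!: bilinear_relation_in_span)

lemma single_mult_span:
  assumes "a \<in> carrier A" "b \<in> carrier B" "r \<in> J"
  shows "Poly_Mapping.single (a, b) c \<otimes>\<^bsub>M\<^esub> r \<in> J \<and> r \<otimes>\<^bsub>M\<^esub> Poly_Mapping.single (a, b) c \<in> J"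
proof -
  have "Poly_Mapping.keys r \<subseteq> carrier A \<times> carrier B
    \<and> Poly_Mapping.single (a, b) c \<otimes>\<^bsub>M\<^esub> r \<in> J \<and> r \<otimes>\<^bsub>M\<^esub> Poly_Mapping.single (a, b) c \<in> J"
    using assms(3) unfolding bilinear_span_def
  proof (induction r rule: scale_pm.span_induct_alt)
    case base
    show ?case by (simp add: scale_pm.span_zero)
  next
    case (step d r s)
    have r: "Poly_Mapping.keys r \<subseteq> carrier A \<times> carrier B"
      using bilinear_relators_carrier[OF step(1)] by simp
    have "Poly_Mapping.keys (scale_pm d r) \<subseteq> carrier A \<times> carrier B"
      using keys_scale_pm r by (rule order_trans)
    thus ?case
      using step(2) single_mult_relator[OF assms(1,2) step(1), of c] assms(1,2) r
      by (simp add: keys_add_subset monoid_algebra_mult_add_left monoid_algebra_mult_add_right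
          pair.monoid_algebra_scale scale_pm.span_add scale_pm.span_scale bilinear_span_def)
  qed
  thus ?thesis by blast
qed

lemma mult_span:
  assumes "f \<in> carrier M" "r \<in> J"
  shows "f \<otimes>\<^bsub>M\<^esub> r \<in> J \<and> r \<otimes>\<^bsub>M\<^esub> f \<in> J"
proof -
  from assms(1) have "Poly_Mapping.keys f \<subseteq> carrier A \<times> carrier B" by simp
  thus ?thesis
  proof (induction f rule: poly_mapping_keys_induct)
    case zero
    show ?case by (simp add: bilinear_span_def scale_pm.span_zero)
  next
    case (single p c)
    thus ?case using assms(2) single_mult_span[of "fst p" "snd p" r c] by auto
  next
    case (add f g)
    thus ?case
      by (simp add: monoid_algebra_mult_add_left monoid_algebra_mult_add_right
          bilinear_span_def scale_pm.span_add)
  qed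
qed

sublocale algebra_quotient M J
proof -
  have "subgroup J (add_monoid M)"
  proof (rule M.add.subgroupI)
    fix r assume r: "r \<in> J"
    have "\<ominus>\<^bsub>M\<^esub> r = (- 1) \<odot>\<^bsub>M\<^esub> r"
      using bilinear_span_carrier[OF r] by (intro M.scale_minus_one[symmetric]) simp
    also have "\<dots> \<in> J"
      using r by (simp add: bilinear_span_def scale_pm.span_neg)
    finally show "\<ominus>\<^bsub>M\<^esub> r \<in> J" .
  qed (use bilinear_span_carrier scale_pm.span_zero in \<open>auto simp: bilinear_span_def scale_pm.span_add\<close>)
  hence "ideal J M"
    using mult_span by (intro idealI M.ring_axioms) auto
  thus "algebra_quotient M J"
    by (intro algebra_quotient.intro M.complex_algebra_axioms)
qed

abbreviation "T \<equiv> tensor_algebra A B"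

abbreviation tens (infixl \<open>\<diamondop>\<close> 75) where "a \<diamondop> b \<equiv> tensor_elem A B a b"

lemma complex_algebra_tensor: "complex_algebra T"
  unfolding tensor_algebra_def by (rule complex_algebra_quot)

sublocale T: complex_algebra T
  by (rule complex_algebra_tensor)

lemma algebra_hom_tensor_coset: "algebra_hom M T (\<lambda>f. J +>\<^bsub>M\<^esub> f)"
  unfolding tensor_algebra_def by (rule algebra_hom_coset)

lemmas coset_hom = algebra_homD[OF algebra_hom_tensor_coset]

lemma tens_closed [simp, intro]:
  "a \<in> carrier A \<Longrightarrow> b \<in> carrier B \<Longrightarrow> a \<diamondop> b \<in> carrier T"
  unfolding tensor_elem_def by (rule coset_hom(1)) simp

lemma coset_eq_if_diff:
  assumes "f - g \<in> J" "g \<in> carrier M"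
  shows "J +>\<^bsub>M\<^esub> f = J +>\<^bsub>M\<^esub> g"
  using coset_eqI[of g "f - g"] assms by simp

lemma tens_add_left:
  assumes "a \<in> carrier A" "a' \<in> carrier A" "b \<in> carrier B"
  shows "(a \<oplus>\<^bsub>A\<^esub> a') \<diamondop> b = a \<diamondop> b \<oplus>\<^bsub>T\<^esub> a' \<diamondop> b"
  using assms bilinear_relation_in_span(1)[OF assms, of 1]
    coset_hom(2)[of "Poly_Mapping.single (a, b) 1" "Poly_Mapping.single (a', b) 1"]
    coset_eq_if_diff[of "Poly_Mapping.single (a \<oplus>\<^bsub>A\<^esub> a', b) 1"
      "Poly_Mapping.single (a, b) 1 + Poly_Mapping.single (a', b) 1"]
  by (simp add: tensor_elem_def keys_add_subset diff_diff_eq)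

lemma tens_add_right:
  assumes "a \<in> carrier A" "b \<in> carrier B" "b' \<in> carrier B"
  shows "a \<diamondop> (b \<oplus>\<^bsub>B\<^esub> b') = a \<diamondop> b \<oplus>\<^bsub>T\<^esub> a \<diamondop> b'"
  using assms bilinear_relation_in_span(2)[OF assms, of 1]
    coset_hom(2)[of "Poly_Mapping.single (a, b) 1" "Poly_Mapping.single (a, b') 1"]
    coset_eq_if_diff[of "Poly_Mapping.single (a, b \<oplus>\<^bsub>B\<^esub> b') 1"
      "Poly_Mapping.single (a, b) 1 + Poly_Mapping.single (a, b') 1"]
  by (simp add: tensor_elem_def keys_add_subset diff_diff_eq)

lemma coset_single:
  assumes "a \<in> carrier A" "b \<in> carrier B"
  shows "J +>\<^bsub>M\<^esub> Poly_Mapping.single (a, b) c = c \<odot>\<^bsub>T\<^esub> (a \<diamondop> b)"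
  using coset_hom(3)[of "Poly_Mapping.single (a, b) 1" c] assms by (simp add: tensor_elem_def)

lemma tens_scale_left:
  assumes "a \<in> carrier A" "b \<in> carrier B"
  shows "(c \<odot>\<^bsub>A\<^esub> a) \<diamondop> b = c \<odot>\<^bsub>T\<^esub> (a \<diamondop> b)"
  using assms bilinear_relation_in_span(3)[OF assms, of c 1]
    coset_eq_if_diff[of "Poly_Mapping.single (c \<odot>\<^bsub>A\<^esub> a, b) 1" "Poly_Mapping.single (a, b) c"]
  by (simp add: coset_single[symmetric]) (simp add: tensor_elem_def)

lemma tens_scale_right:
  assumes "a \<in> carrier A" "b \<in> carrier B"
  shows "a \<diamondop> (c \<odot>\<^bsub>B\<^esub> b) = c \<odot>\<^bsub>T\<^esub> (a \<diamondop> b)"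
  using assms bilinear_relation_in_span(4)[OF assms, of c 1]
    coset_eq_if_diff[of "Poly_Mapping.single (a, c \<odot>\<^bsub>B\<^esub> b) 1" "Poly_Mapping.single (a, b) c"]
  by (simp add: coset_single[symmetric]) (simp add: tensor_elem_def)

lemma tens_mult:
  assumes "a \<in> carrier A" "b \<in> carrier B" "a' \<in> carrier A" "b' \<in> carrier B"
  shows "(a \<diamondop> b) \<otimes>\<^bsub>T\<^esub> (a' \<diamondop> b') = (a \<otimes>\<^bsub>A\<^esub> a') \<diamondop> (b \<otimes>\<^bsub>B\<^esub> b')"
  using coset_hom(4)[of "Poly_Mapping.single (a, b) 1" "Poly_Mapping.single (a', b') 1"] assms
  by (simp add: tensor_elem_def)

lemma tens_one: "\<one>\<^bsub>A\<^esub> \<diamondop> \<one>\<^bsub>B\<^esub> = \<one>\<^bsub>T\<^esub>"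
  using coset_hom(5) by (simp add: tensor_elem_def)

text \<open>
  Scalars can be moved into the left factor of a pure tensor, so sums of pure tensors already
  exhaust the tensor product.
\<close>
lemma tensor_induct [consumes 1, case_names tens add]:
  assumes "t \<in> carrier T"
    and tens: "\<And>a b. a \<in> carrier A \<Longrightarrow> b \<in> carrier B \<Longrightarrow> Q (a \<diamondop> b)"
    and add: "\<And>s t. s \<in> carrier T \<Longrightarrow> t \<in> carrier T \<Longrightarrow> Q s \<Longrightarrow> Q t \<Longrightarrow> Q (s \<oplus>\<^bsub>T\<^esub> t)"
  shows "Q t"
proof -
  from assms(1) obtain f where f: "Poly_Mapping.keys f \<subseteq> carrier A \<times> carrier B" "t = J +>\<^bsub>M\<^esub> f"
    unfolding tensor_algebra_def by (auto elim!: cosetE)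
  have single: "Q (J +>\<^bsub>M\<^esub> Poly_Mapping.single p c)" if "p \<in> carrier A \<times> carrier B" for p c
  proof -
    from that obtain a b where "p = (a, b)" "a \<in> carrier A" "b \<in> carrier B" by blast
    thus ?thesis
      using tens[of "c \<odot>\<^bsub>A\<^esub> a" b] by (simp add: coset_single tens_scale_left)
  qed
  have "Q (J +>\<^bsub>M\<^esub> f)" using f(1)
  proof (induction f rule: poly_mapping_keys_induct)
    case zero
    show ?case using single[of "(\<one>\<^bsub>A\<^esub>, \<one>\<^bsub>B\<^esub>)" 0] by simp
  next
    case (add f g)
    thus ?case using coset_hom(2)[of f g] coset_hom(1) assms(3) by simp
  qed (rule single)
  thus ?thesis by (simp add: f)
qed

definition bilinear :: "(complex, 'v) module \<Rightarrow> ('a \<Rightarrow> 'b \<Rightarrow> 'v) \<Rightarrow> bool" where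
  "bilinear V \<beta> \<longleftrightarrow> (\<forall>a\<in>carrier A. linear_map B V (\<beta> a)) \<and> (\<forall>b\<in>carrier B. linear_map A V (\<lambda>a. \<beta> a b))"

lemma bilinearI:
  assumes "\<And>a. a \<in> carrier A \<Longrightarrow> linear_map B V (\<beta> a)"
    and "\<And>b. b \<in> carrier B \<Longrightarrow> linear_map A V (\<lambda>a. \<beta> a b)"
  shows "bilinear V \<beta>"
  using assms by (simp add: bilinear_def)

context
  fixes V :: "(complex, 'v) module" and \<beta>
  assumes V: "complex_space V" and \<beta>: "bilinear V \<beta>"
begin

interpretation V: complex_space V by (rule V)

lemma bilinearD:
  assumes "a \<in> carrier A" "b \<in> carrier B"
  shows "\<beta> a b \<in> carrier V"
    and "a' \<in> carrier A \<Longrightarrow> \<beta> (a \<oplus>\<^bsub>A\<^esub> a') b = \<beta> a b \<oplus>\<^bsub>V\<^esub> \<beta> a' b"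
    and "b' \<in> carrier B \<Longrightarrow> \<beta> a (b \<oplus>\<^bsub>B\<^esub> b') = \<beta> a b \<oplus>\<^bsub>V\<^esub> \<beta> a b'"
    and "\<beta> (c \<odot>\<^bsub>A\<^esub> a) b = c \<odot>\<^bsub>V\<^esub> \<beta> a b"
    and "\<beta> a (c \<odot>\<^bsub>B\<^esub> b) = c \<odot>\<^bsub>V\<^esub> \<beta> a b"
  using assms \<beta> unfolding bilinear_def linear_map_def by auto

lemma tensor_lift_props:
  shows tensor_lift_tens: "a \<in> carrier A \<Longrightarrow> b \<in> carrier B \<Longrightarrow> tensor_lift V \<beta> (a \<diamondop> b) = \<beta> a b"
    and tensor_lift_linear: "linear_map T V (tensor_lift V \<beta>)"
proof -
  let ?h = "lin_ext V (\<lambda>p. \<beta> (fst p) (snd p))"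
  let ?K = "carrier A \<times> carrier B"
  have car: "(\<lambda>p. \<beta> (fst p) (snd p)) \<in> ?K \<rightarrow> carrier V"
    using bilinearD(1) by auto
  note diff = V.lin_ext_diff_eq_zero[OF car]
  have lin: "linear_map M V ?h"
    by (rule linear_map_lin_ext[OF V]) (use car in simp)
  have rel: "?h r = \<zero>\<^bsub>V\<^esub>" if "r \<in> bilinear_relators A B" for r
    using that unfolding bilinear_relators_def diff_diff_eq
    by (elim UnE CollectE exE conjE)
      (simp_all add: diff keys_add_subset V.lin_ext_add[OF car] V.lin_ext_single bilinearD)
  have ker: "?h r = \<zero>\<^bsub>V\<^esub>" if "r \<in> J" for r
  proof -
    have "Poly_Mapping.keys r \<subseteq> ?K \<and> ?h r = \<zero>\<^bsub>V\<^esub>"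
      using that unfolding bilinear_span_def
    proof (induction r rule: scale_pm.span_induct)
      case base
      show ?case
        by (rule scale_pm.subspaceI)
          (simp_all add: keys_add_subset order_trans[OF keys_scale_pm]
            V.lin_ext_add[OF car] V.lin_ext_scale[OF car])
    next
      case (step r)
      thus ?case using bilinear_relators_carrier rel by simp
    qed
    thus ?thesis by blast
  qed
  have lift: "tensor_lift V \<beta> t = the_elem (?h ` t)" for t
    by (simp add: tensor_lift_def lin_ext_def)
  show "tensor_lift V \<beta> (a \<diamondop> b) = \<beta> a b" if "a \<in> carrier A" "b \<in> carrier B"
    using factor_coset[OF V lin ker, of "Poly_Mapping.single (a, b) 1"] that
    by (simp add: lift tensor_elem_def V.lin_ext_single bilinearD)
  show "linear_map T V (tensor_lift V \<beta>)"
    using linear_map_factor[OF V lin ker] unfolding lift[abs_def] tensor_algebra_def .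
qed

end

text \<open>
  Multiplicativity of the lift is an identity that is linear in both factors, so pure tensors
  suffice.
\<close>
lemma tensor_lift_hom:
  assumes V: "complex_algebra V" and \<beta>: "bilinear V \<beta>"
    and mult: "\<And>a b a' b'. a \<in> carrier A \<Longrightarrow> b \<in> carrier B \<Longrightarrow> a' \<in> carrier A \<Longrightarrow> b' \<in> carrier B \<Longrightarrow>
      \<beta> (a \<otimes>\<^bsub>A\<^esub> a') (b \<otimes>\<^bsub>B\<^esub> b') = \<beta> a b \<otimes>\<^bsub>V\<^esub> \<beta> a' b'"
    and one: "\<beta> \<one>\<^bsub>A\<^esub> \<one>\<^bsub>B\<^esub> = \<one>\<^bsub>V\<^esub>"
  shows "algebra_hom T V (tensor_lift V \<beta>)"
proof -
  interpret V: complex_algebra V by fact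
  note tens' = tensor_lift_tens[OF complex_algebra_space[OF V] \<beta>]
  note lin = tensor_lift_linear[OF complex_algebra_space[OF V] \<beta>]
  note lin' = linear_mapD[OF lin]
  show ?thesis
  proof (rule algebra_homI[OF lin])
    fix s t assume s: "s \<in> carrier T" and t: "t \<in> carrier T"
    show "tensor_lift V \<beta> (s \<otimes>\<^bsub>T\<^esub> t) = tensor_lift V \<beta> s \<otimes>\<^bsub>V\<^esub> tensor_lift V \<beta> t"
      using s
    proof (induction s rule: tensor_induct)
      case (tens a b)
      show ?case using t
        by (induction t rule: tensor_induct)
          (use tens in \<open>simp_all add: tens_mult tens' mult T.r_distr V.r_distr lin'
            bilinearD(1)[OF complex_algebra_space[OF V] \<beta>]\<close>)
    qed (use t in \<open>simp_all add: T.l_distr V.l_distr lin'\<close>)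
  qed (simp add: tens_one[symmetric] tens' one)
qed

end

section \<open>The canonical maps between tensor products\<close>

lemma algebra_pairI: "complex_algebra A \<Longrightarrow> complex_algebra B \<Longrightarrow> algebra_pair A B"
  by (simp add: algebra_pair_def)

lemma complex_algebra_tensor: "complex_algebra A \<Longrightarrow> complex_algebra B \<Longrightarrow> complex_algebra (tensor_algebra A B)"
  by (intro algebra_pair.complex_algebra_tensor algebra_pairI)

context
  fixes A :: "(complex, 'a) module" and B :: "(complex, 'b) module"
    and C :: "(complex, 'c) module" and D :: "(complex, 'd) module"
  assumes A: "complex_algebra A" and B: "complex_algebra B"
    and C: "complex_algebra C" and D: "complex_algebra D"
begin

interpretation AB: algebra_pair A B by (rule algebra_pairI[OF A B])
interpretation CD: algebra_pair C D by (rule algebra_pairI[OF C D])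

lemma tensor_map_bilinear:
  assumes "linear_map A C f" "linear_map B D g"
  shows "AB.bilinear (tensor_algebra C D) (\<lambda>a b. tensor_elem C D (f a) (g b))"
  by (intro AB.bilinearI linear_mapI)
    (simp_all add: linear_mapD[OF assms(1)] linear_mapD[OF assms(2)]
      CD.tens_add_left CD.tens_add_right CD.tens_scale_left CD.tens_scale_right)

lemma tensor_map_tens:
  assumes "linear_map A C f" "linear_map B D g" "a \<in> carrier A" "b \<in> carrier B"
  shows "tensor_map C D f g (tensor_elem A B a b) = tensor_elem C D (f a) (g b)"
  unfolding tensor_map_def
  by (rule AB.tensor_lift_tens[OF complex_algebra_space[OF CD.complex_algebra_tensor]
        tensor_map_bilinear[OF assms(1,2)] assms(3,4)])

lemma tensor_map_linear:
  assumes "linear_map A C f" "linear_map B D g"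
  shows "linear_map (tensor_algebra A B) (tensor_algebra C D) (tensor_map C D f g)"
  unfolding tensor_map_def
  by (rule AB.tensor_lift_linear[OF complex_algebra_space[OF CD.complex_algebra_tensor]
        tensor_map_bilinear[OF assms]])

lemma tensor_map_hom:
  assumes "algebra_hom A C f" "algebra_hom B D g"
  shows "algebra_hom (tensor_algebra A B) (tensor_algebra C D) (tensor_map C D f g)"
  unfolding tensor_map_def
  by (rule AB.tensor_lift_hom[OF CD.complex_algebra_tensor
        tensor_map_bilinear[OF algebra_homD(6)[OF assms(1)] algebra_homD(6)[OF assms(2)]]])
    (simp_all add: algebra_homD[OF assms(1)] algebra_homD[OF assms(2)] CD.tens_mult CD.tens_one)

end

context
  fixes A :: "(complex, 'a) module" and B :: "(complex, 'b) module"
  assumes A: "complex_algebra A" and B: "complex_algebra B"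
begin

interpretation AB: algebra_pair A B by (rule algebra_pairI[OF A B])
interpretation BA: algebra_pair B A by (rule algebra_pairI[OF B A])

lemma tensor_flip_bilinear: "AB.bilinear (tensor_algebra B A) (\<lambda>a b. tensor_elem B A b a)"
  by (intro AB.bilinearI linear_mapI)
    (simp_all add: BA.tens_add_left BA.tens_add_right BA.tens_scale_left BA.tens_scale_right)

lemma tensor_flip_tens:
  assumes "a \<in> carrier A" "b \<in> carrier B"
  shows "tensor_flip A B (tensor_elem A B a b) = tensor_elem B A b a"
  unfolding tensor_flip_def
  by (rule AB.tensor_lift_tens[OF complex_algebra_space[OF BA.complex_algebra_tensor]
        tensor_flip_bilinear assms])

lemma tensor_flip_hom:
  "algebra_hom (tensor_algebra A B) (tensor_algebra B A) (tensor_flip A B)"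
  unfolding tensor_flip_def
  by (rule AB.tensor_lift_hom[OF BA.complex_algebra_tensor tensor_flip_bilinear])
    (simp_all add: BA.tens_mult BA.tens_one)

end

context
  fixes A :: "(complex, 'a) module" and B :: "(complex, 'b) module" and C :: "(complex, 'c) module"
  assumes A: "complex_algebra A" and B: "complex_algebra B" and C: "complex_algebra C"
begin

interpretation AB: algebra_pair A B by (rule algebra_pairI[OF A B])
interpretation BC: algebra_pair B C by (rule algebra_pairI[OF B C])
interpretation L: algebra_pair "tensor_algebra A B" C
  by (rule algebra_pairI[OF AB.complex_algebra_tensor C])
interpretation R: algebra_pair A "tensor_algebra B C"
  by (rule algebra_pairI[OF A BC.complex_algebra_tensor])

lemma nested_tens_bilinear:
  assumes "c \<in> carrier C"
  shows "AB.bilinear R.T (\<lambda>a b. R.tens a (BC.tens b c))"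
  using assms by (intro AB.bilinearI linear_mapI)
    (simp_all add: R.tens_add_left R.tens_add_right R.tens_scale_left R.tens_scale_right
      BC.tens_add_left BC.tens_scale_left)

text \<open>
  The inner lift in \<open>tensor_assoc\<close>: for fixed \<open>c\<close>, the linear map with
  \<open>a \<otimes> b \<mapsto> a \<otimes> (b \<otimes> c)\<close>.
\<close>
definition assoc_slice where
  "assoc_slice t c = tensor_lift R.T (\<lambda>a b. R.tens a (BC.tens b c)) t"

lemma assoc_slice_tens:
  assumes "a \<in> carrier A" "b \<in> carrier B" "c \<in> carrier C"
  shows "assoc_slice (AB.tens a b) c = R.tens a (BC.tens b c)"
  unfolding assoc_slice_def
  by (rule AB.tensor_lift_tens[OF complex_algebra_space[OF R.complex_algebra_tensor]
        nested_tens_bilinear[OF assms(3)] assms(1,2)])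

lemma assoc_slice_linear:
  assumes "c \<in> carrier C"
  shows "linear_map AB.T R.T (\<lambda>t. assoc_slice t c)"
  unfolding assoc_slice_def
  by (rule AB.tensor_lift_linear[OF complex_algebra_space[OF R.complex_algebra_tensor]
        nested_tens_bilinear[OF assms]])

text \<open>
  Linearity in \<open>t\<close> holds by construction. Linearity in \<open>c\<close> is an identity between functions that are
  linear in \<open>t\<close>, so it can be checked on pure tensors.
\<close>
lemma assoc_slice_bilinear: "L.bilinear R.T assoc_slice"
proof (rule L.bilinearI)
  fix t assume t: "t \<in> carrier AB.T"
  note lin = linear_mapD[OF assoc_slice_linear]
  show "linear_map C R.T (assoc_slice t)"
  proof (rule linear_mapI)
    fix c d assume cd: "c \<in> carrier C" "d \<in> carrier C"
    from t show "assoc_slice t (c \<oplus>\<^bsub>C\<^esub> d) = assoc_slice t c \<oplus>\<^bsub>R.T\<^esub> assoc_slice t d"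
      by (induction t rule: AB.tensor_induct)
        (use cd in \<open>simp_all add: assoc_slice_tens BC.tens_add_right R.tens_add_right lin R.T.a_ac\<close>)
  next
    fix k c assume c: "c \<in> carrier C"
    from t show "assoc_slice t (k \<odot>\<^bsub>C\<^esub> c) = k \<odot>\<^bsub>R.T\<^esub> assoc_slice t c"
      by (induction t rule: AB.tensor_induct)
        (use c in \<open>simp_all add: assoc_slice_tens BC.tens_scale_right R.tens_scale_right lin
          R.T.scale_add_right\<close>)
  qed (use t lin in simp)
qed (rule assoc_slice_linear)

lemma assoc_slice_mult:
  assumes "s \<in> carrier AB.T" "t \<in> carrier AB.T" and c: "c \<in> carrier C" "d \<in> carrier C"
  shows "assoc_slice (s \<otimes>\<^bsub>AB.T\<^esub> t) (c \<otimes>\<^bsub>C\<^esub> d) = assoc_slice s c \<otimes>\<^bsub>R.T\<^esub> assoc_slice t d"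
  using assms(1)
proof (induction s rule: AB.tensor_induct)
  note lin = linear_mapD[OF assoc_slice_linear]
  case (tens a b)
  show ?case using assms(2)
    by (induction t rule: AB.tensor_induct)
      (use tens c in \<open>simp_all add: AB.tens_mult assoc_slice_tens BC.tens_mult R.tens_mult lin
        AB.T.r_distr R.T.r_distr\<close>)
next
  note lin = linear_mapD[OF assoc_slice_linear]
  case (add s s')
  thus ?case using assms(2) c by (simp add: AB.T.l_distr R.T.l_distr lin)
qed

lemma tensor_assoc_eq: "tensor_assoc A B C = tensor_lift R.T assoc_slice"
  unfolding tensor_assoc_def assoc_slice_def[abs_def] ..

lemma tensor_assoc_tens:
  assumes "a \<in> carrier A" "b \<in> carrier B" "c \<in> carrier C"
  shows "tensor_assoc A B C (L.tens (AB.tens a b) c) = R.tens a (BC.tens b c)"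
  unfolding tensor_assoc_eq
  using L.tensor_lift_tens[OF complex_algebra_space[OF R.complex_algebra_tensor] assoc_slice_bilinear,
      of "AB.tens a b" c] assms
  by (simp add: assoc_slice_tens)

lemma tensor_assoc_hom: "algebra_hom L.T R.T (tensor_assoc A B C)"
  unfolding tensor_assoc_eq
  by (rule L.tensor_lift_hom[OF R.complex_algebra_tensor assoc_slice_bilinear])
    (simp_all add: assoc_slice_mult AB.tens_one[symmetric] assoc_slice_tens BC.tens_one R.tens_one)

end

context
  fixes A :: "(complex, 'a) module"
  assumes A: "complex_algebra A"
begin

interpretation complex_algebra A by (rule A)
interpretation AA: algebra_pair A A by (rule algebra_pairI[OF A A])
interpretation CA: algebra_pair complex_alg A by (rule algebra_pairI[OF complex_algebra_complex_alg A])
interpretation AC: algebra_pair A complex_alg by (rule algebra_pairI[OF A complex_algebra_complex_alg])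

lemma unit_left_bilinear: "CA.bilinear A (\<lambda>c v. c \<odot>\<^bsub>A\<^esub> v)"
  by (intro CA.bilinearI linear_mapI)
    (simp_all add: scale_add_left scale_add_right scale_scale mult.commute)

lemma unit_right_bilinear: "AC.bilinear A (\<lambda>v c. c \<odot>\<^bsub>A\<^esub> v)"
  by (intro AC.bilinearI linear_mapI)
    (simp_all add: scale_add_left scale_add_right scale_scale mult.commute)

lemma mult_bilinear: "AA.bilinear A (\<lambda>a b. a \<otimes>\<^bsub>A\<^esub> b)"
  by (intro AA.bilinearI linear_mapI)
    (simp_all add: l_distr r_distr smult_mult_left smult_mult_right)

lemma tensor_unit_left_tens:
  assumes "a \<in> carrier A"
  shows "tensor_unit_left A (tensor_elem complex_alg A c a) = c \<odot>\<^bsub>A\<^esub> a"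
  unfolding tensor_unit_left_def
  by (rule CA.tensor_lift_tens[OF complex_algebra_space[OF A] unit_left_bilinear])
    (simp_all add: assms)

lemma tensor_unit_left_hom: "algebra_hom CA.T A (tensor_unit_left A)"
  unfolding tensor_unit_left_def
  by (rule CA.tensor_lift_hom[OF A unit_left_bilinear])
    (simp_all add: smult_mult_left smult_mult_right scale_scale mult.commute)

lemma tensor_unit_right_tens:
  assumes "a \<in> carrier A"
  shows "tensor_unit_right A (tensor_elem A complex_alg a c) = c \<odot>\<^bsub>A\<^esub> a"
  unfolding tensor_unit_right_def
  by (rule AC.tensor_lift_tens[OF complex_algebra_space[OF A] unit_right_bilinear])
    (simp_all add: assms)

lemma tensor_unit_right_hom: "algebra_hom AC.T A (tensor_unit_right A)"
  unfolding tensor_unit_right_def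
  by (rule AC.tensor_lift_hom[OF A unit_right_bilinear])
    (simp_all add: smult_mult_left smult_mult_right scale_scale mult.commute)

lemma tensor_mult_tens:
  assumes "a \<in> carrier A" "b \<in> carrier A"
  shows "tensor_mult A (tensor_elem A A a b) = a \<otimes>\<^bsub>A\<^esub> b"
  unfolding tensor_mult_def
  by (rule AA.tensor_lift_tens[OF complex_algebra_space[OF A] mult_bilinear assms])

lemma tensor_mult_linear: "linear_map AA.T A (tensor_mult A)"
  unfolding tensor_mult_def
  by (rule AA.tensor_lift_linear[OF complex_algebra_space[OF A] mult_bilinear])

context
  fixes S
  assumes S: "algebra_antihom A A S"
begin

lemma antihomD:
  shows "x \<in> carrier A \<Longrightarrow> S x \<in> carrier A"
    and "x \<in> carrier A \<Longrightarrow> y \<in> carrier A \<Longrightarrow> S (x \<oplus>\<^bsub>A\<^esub> y) = S x \<oplus>\<^bsub>A\<^esub> S y"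
    and "x \<in> carrier A \<Longrightarrow> S (c \<odot>\<^bsub>A\<^esub> x) = c \<odot>\<^bsub>A\<^esub> S x"
    and "x \<in> carrier A \<Longrightarrow> y \<in> carrier A \<Longrightarrow> S (x \<otimes>\<^bsub>A\<^esub> y) = S y \<otimes>\<^bsub>A\<^esub> S x"
    and "S \<one>\<^bsub>A\<^esub> = \<one>\<^bsub>A\<^esub>"
    and "linear_map A A S"
  using algebra_homD[OF S[unfolded algebra_antihom_iff]] by (simp_all add: linear_map_def)

lemmas id_linear = algebra_homD(6)[OF algebra_hom_id[of A]]

lemma antipode_map_tens:
  assumes "a \<in> carrier A" "b \<in> carrier A"
  shows "tensor_mult A (tensor_map A A S id (AA.tens a b)) = S a \<otimes>\<^bsub>A\<^esub> b"
    and "tensor_mult A (tensor_map A A id S (AA.tens a b)) = a \<otimes>\<^bsub>A\<^esub> S b"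
  using assms
  by (simp_all add: tensor_map_tens[OF A A A A antihomD(6) id_linear]
      tensor_map_tens[OF A A A A id_linear antihomD(6)] tensor_mult_tens antihomD(1))

lemma antipode_map_linear:
  "linear_map AA.T A (\<lambda>t. tensor_mult A (tensor_map A A S id t))"
  "linear_map AA.T A (\<lambda>t. tensor_mult A (tensor_map A A id S t))"
  by (rule linear_map_compose[OF tensor_map_linear[OF A A A A] tensor_mult_linear],
      rule antihomD(6) id_linear, rule antihomD(6) id_linear)+

text \<open>
  On pure tensors, \<open>m (S \<otimes> id) ((a \<otimes> b) (c \<otimes> d)) = S c (S a b) d\<close>: the contribution of the left
  factor sits between \<open>S c\<close> and \<open>d\<close>, and a scalar there can be pulled out.
\<close>
lemma antipode_left_mult:
  assumes s: "s \<in> carrier AA.T" "tensor_mult A (tensor_map A A S id s) = k \<odot>\<^bsub>A\<^esub> \<one>\<^bsub>A\<^esub>"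
    and t: "t \<in> carrier AA.T"
  shows "tensor_mult A (tensor_map A A S id (s \<otimes>\<^bsub>AA.T\<^esub> t)) = k \<odot>\<^bsub>A\<^esub> tensor_mult A (tensor_map A A S id t)"
proof -
  define F where "F = (\<lambda>t. tensor_mult A (tensor_map A A S id t))"
  have F: "F s = k \<odot>\<^bsub>A\<^esub> \<one>\<^bsub>A\<^esub>" using s(2) by (simp only: F_def)
  have tens: "F (AA.tens a b) = S a \<otimes>\<^bsub>A\<^esub> b" if "a \<in> carrier A" "b \<in> carrier A" for a b
    unfolding F_def using that by (rule antipode_map_tens)
  note lin = linear_mapD[OF antipode_map_linear(1)[folded F_def]]
  have *: "F (s \<otimes>\<^bsub>AA.T\<^esub> AA.tens a b) = S a \<otimes>\<^bsub>A\<^esub> F s \<otimes>\<^bsub>A\<^esub> b"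
    if "a \<in> carrier A" "b \<in> carrier A" for a b
    using s(1)
    by (induction s rule: AA.tensor_induct)
      (use that in \<open>simp_all add: AA.tens_mult tens antihomD m_assoc lin
        AA.T.l_distr l_distr r_distr\<close>)
  have "F (s \<otimes>\<^bsub>AA.T\<^esub> t) = k \<odot>\<^bsub>A\<^esub> F t"
    using t
    by (induction t rule: AA.tensor_induct)
      (use s(1) F in \<open>simp_all add: * tens antihomD smult_mult_left smult_mult_right lin
        AA.T.r_distr AA.T.l_distr scale_add_right\<close>)
  thus ?thesis by (simp only: F_def)
qed

text \<open>
  Here \<open>m (id \<otimes> S) ((a \<otimes> b) (c \<otimes> d)) = a (c S d) S b\<close>, so the roles of the two factors are exchanged.
\<close>
lemma antipode_right_mult:
  assumes s: "s \<in> carrier AA.T"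
    and t: "t \<in> carrier AA.T" "tensor_mult A (tensor_map A A id S t) = k \<odot>\<^bsub>A\<^esub> \<one>\<^bsub>A\<^esub>"
  shows "tensor_mult A (tensor_map A A id S (s \<otimes>\<^bsub>AA.T\<^esub> t)) = k \<odot>\<^bsub>A\<^esub> tensor_mult A (tensor_map A A id S s)"
proof -
  define F where "F = (\<lambda>t. tensor_mult A (tensor_map A A id S t))"
  have F: "F t = k \<odot>\<^bsub>A\<^esub> \<one>\<^bsub>A\<^esub>" using t(2) by (simp only: F_def)
  have tens: "F (AA.tens a b) = a \<otimes>\<^bsub>A\<^esub> S b" if "a \<in> carrier A" "b \<in> carrier A" for a b
    unfolding F_def using that by (rule antipode_map_tens)
  note lin = linear_mapD[OF antipode_map_linear(2)[folded F_def]]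
  have *: "F (AA.tens a b \<otimes>\<^bsub>AA.T\<^esub> t) = a \<otimes>\<^bsub>A\<^esub> F t \<otimes>\<^bsub>A\<^esub> S b"
    if "a \<in> carrier A" "b \<in> carrier A" for a b
    using t(1)
    by (induction t rule: AA.tensor_induct)
      (use that in \<open>simp_all add: AA.tens_mult tens antihomD m_assoc lin
        AA.T.r_distr l_distr r_distr\<close>)
  have "F (s \<otimes>\<^bsub>AA.T\<^esub> t) = k \<odot>\<^bsub>A\<^esub> F s"
    using s
    by (induction s rule: AA.tensor_induct)
      (use t(1) F in \<open>simp_all add: * tens antihomD smult_mult_left smult_mult_right lin
        AA.T.r_distr AA.T.l_distr scale_add_right\<close>)
  thus ?thesis by (simp only: F_def)
qed

end

end

section \<open>Checking the Hopf algebra axioms on generators\<close>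

context presentation
begin

abbreviation "gen \<equiv> presented_gen L R"

text \<open>
  The coassociativity and counit laws equate algebra homomorphisms. The antipode laws hold for \<open>1\<close>,
  are linear, and survive left multiplication by a generator that satisfies them.
\<close>
lemma hopf_algebra_if_gens:
  assumes comult: "algebra_hom P (tensor_algebra P P) \<Delta>"
    and counit: "algebra_hom P complex_alg \<epsilon>"
    and antipode: "algebra_antihom P P S"
    and coassoc: "\<And>g. g \<in> L \<Longrightarrow> tensor_assoc P P P (tensor_map (tensor_algebra P P) P \<Delta> id (\<Delta> (gen g)))
        = tensor_map P (tensor_algebra P P) id \<Delta> (\<Delta> (gen g))"
    and counit_left: "\<And>g. g \<in> L \<Longrightarrow> tensor_unit_left P (tensor_map complex_alg P \<epsilon> id (\<Delta> (gen g))) = gen g"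
    and counit_right: "\<And>g. g \<in> L \<Longrightarrow> tensor_unit_right P (tensor_map P complex_alg id \<epsilon> (\<Delta> (gen g))) = gen g"
    and antipode_left: "\<And>g. g \<in> L \<Longrightarrow> tensor_mult P (tensor_map P P S id (\<Delta> (gen g))) = \<epsilon> (gen g) \<odot>\<^bsub>P\<^esub> \<one>\<^bsub>P\<^esub>"
    and antipode_right: "\<And>g. g \<in> L \<Longrightarrow> tensor_mult P (tensor_map P P id S (\<Delta> (gen g))) = \<epsilon> (gen g) \<odot>\<^bsub>P\<^esub> \<one>\<^bsub>P\<^esub>"
  shows "complex_hopf_algebra P \<Delta> \<epsilon> S"
proof -
  note P = complex_algebra_presented and C = complex_algebra_complex_alg
  note PP = complex_algebra_tensor[OF P P]
  interpret P: complex_algebra P by (rule P)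
  interpret PP: algebra_pair P P by (rule algebra_pairI[OF P P])
  note \<Delta> = algebra_homD[OF comult] and \<epsilon> = algebra_homD[OF counit]
  note eqI = presented_hom_eqI
  have coalg: "complex_coalgebra P \<Delta> \<epsilon>"
  proof (intro complex_coalgebra.intro complex_coalgebra_axioms.intro)
    show "Module.module complex_alg P"
      using complex_algebra_space[OF P] by (simp add: complex_space_def)
    show "linear_map P (tensor_algebra P P) \<Delta>" "linear_map P complex_alg \<epsilon>"
      by (rule \<Delta> \<epsilon>)+
    fix a assume a: "a \<in> carrier P"
    have "algebra_hom P (tensor_algebra P (tensor_algebra P P))
        (\<lambda>a. tensor_assoc P P P (tensor_map (tensor_algebra P P) P \<Delta> id (\<Delta> a)))"
      by (rule algebra_hom_compose[OF algebra_hom_compose[OF comult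
              tensor_map_hom[OF P P PP P comult algebra_hom_id]] tensor_assoc_hom[OF P P P]])
    moreover have "algebra_hom P (tensor_algebra P (tensor_algebra P P))
        (\<lambda>a. tensor_map P (tensor_algebra P P) id \<Delta> (\<Delta> a))"
      by (rule algebra_hom_compose[OF comult tensor_map_hom[OF P P P PP algebra_hom_id comult]])
    ultimately show "tensor_assoc P P P (tensor_map (tensor_algebra P P) P \<Delta> id (\<Delta> a))
        = tensor_map P (tensor_algebra P P) id \<Delta> (\<Delta> a)"
      using coassoc a by (rule eqI[OF complex_algebra_tensor[OF P PP]])
    have id: "algebra_hom P P (\<lambda>a. a)" using algebra_hom_id[of P] by (simp add: id_def)
    have "algebra_hom P P (\<lambda>a. tensor_unit_left P (tensor_map complex_alg P \<epsilon> id (\<Delta> a)))"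
      by (rule algebra_hom_compose[OF algebra_hom_compose[OF comult
              tensor_map_hom[OF P P C P counit algebra_hom_id]] tensor_unit_left_hom[OF P]])
    thus "tensor_unit_left P (tensor_map complex_alg P \<epsilon> id (\<Delta> a)) = a"
      using id counit_left a by (rule eqI[OF P])
    have "algebra_hom P P (\<lambda>a. tensor_unit_right P (tensor_map P complex_alg id \<epsilon> (\<Delta> a)))"
      by (rule algebra_hom_compose[OF algebra_hom_compose[OF comult
              tensor_map_hom[OF P P P C algebra_hom_id counit]] tensor_unit_right_hom[OF P]])
    thus "tensor_unit_right P (tensor_map P complex_alg id \<epsilon> (\<Delta> a)) = a"
      using id counit_right a by (rule eqI[OF P])
  qed
  show ?thesis
  proof (intro complex_hopf_algebra.intro complex_bialgebra.intro complex_bialgebra_axioms.intro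
      complex_hopf_algebra_axioms.intro P coalg comult counit)
    note S = antihomD[OF P antipode]
    show "linear_map P P S" by (rule S(6))
    \<comment> \<open>The two sides of the antipode law, as linear maps on the tensor square.\<close>
    define F where "F = (\<lambda>t. tensor_mult P (tensor_map P P S id t))"
    define G where "G = (\<lambda>t. tensor_mult P (tensor_map P P id S t))"
    note lin = linear_mapD[OF antipode_map_linear(1)[OF P antipode, folded F_def]]
        linear_mapD[OF antipode_map_linear(2)[OF P antipode, folded G_def]]
    have one: "F \<one>\<^bsub>tensor_algebra P P\<^esub> = \<one>\<^bsub>P\<^esub>" "G \<one>\<^bsub>tensor_algebra P P\<^esub> = \<one>\<^bsub>P\<^esub>"
      using antipode_map_tens[OF P antipode P.one_closed P.one_closed]
      by (simp_all only: F_def G_def PP.tens_one[symmetric] S P.one_closed P.l_one)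
    have F_mult: "F (s \<otimes>\<^bsub>tensor_algebra P P\<^esub> t) = k \<odot>\<^bsub>P\<^esub> F t"
      if "s \<in> carrier (tensor_algebra P P)" "t \<in> carrier (tensor_algebra P P)" "F s = k \<odot>\<^bsub>P\<^esub> \<one>\<^bsub>P\<^esub>"
      for s t k
      using antipode_left_mult[OF P antipode that(1) _ that(2)] that(3) by (simp only: F_def)
    have G_mult: "G (s \<otimes>\<^bsub>tensor_algebra P P\<^esub> t) = k \<odot>\<^bsub>P\<^esub> G s"
      if "s \<in> carrier (tensor_algebra P P)" "t \<in> carrier (tensor_algebra P P)" "G t = k \<odot>\<^bsub>P\<^esub> \<one>\<^bsub>P\<^esub>"
      for s t k
      using antipode_right_mult[OF P antipode that(1,2)] that(3) by (simp only: G_def)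
    have F_gen: "F (\<Delta> (gen g)) = \<epsilon> (gen g) \<odot>\<^bsub>P\<^esub> \<one>\<^bsub>P\<^esub>" and G_gen: "G (\<Delta> (gen g)) = \<epsilon> (gen g) \<odot>\<^bsub>P\<^esub> \<one>\<^bsub>P\<^esub>"
      if "g \<in> L" for g
      using antipode_left[OF that] antipode_right[OF that] by (simp_all only: F_def G_def)
    fix a assume a: "a \<in> carrier P"
    have "F (\<Delta> a) = \<epsilon> a \<odot>\<^bsub>P\<^esub> \<one>\<^bsub>P\<^esub> \<and> G (\<Delta> a) = \<epsilon> a \<odot>\<^bsub>P\<^esub> \<one>\<^bsub>P\<^esub>"
      using a
    proof (induction a rule: presented_induct)
      case (gen_mult g a)
      note g = presented_gen_closed[OF gen_mult(1)]
      have "F (\<Delta> (gen g \<otimes>\<^bsub>P\<^esub> a)) = \<epsilon> (gen g) \<odot>\<^bsub>P\<^esub> F (\<Delta> a)"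
        using gen_mult g by (simp add: \<Delta> F_mult F_gen)
      moreover have "G (\<Delta> (gen g \<otimes>\<^bsub>P\<^esub> a)) = \<epsilon> a \<odot>\<^bsub>P\<^esub> G (\<Delta> (gen g))"
        using gen_mult g by (simp add: \<Delta> G_mult)
      ultimately show ?case
        using gen_mult g by (simp add: \<epsilon> G_gen P.scale_scale mult.commute)
    qed (simp_all add: \<Delta> \<epsilon> lin one P.scale_add_left P.scale_scale)
    thus "tensor_mult P (tensor_map P P S id (\<Delta> a)) = \<epsilon> a \<odot>\<^bsub>P\<^esub> \<one>\<^bsub>P\<^esub>"
      and "tensor_mult P (tensor_map P P id S (\<Delta> a)) = \<epsilon> a \<odot>\<^bsub>P\<^esub> \<one>\<^bsub>P\<^esub>"
      by (simp_all only: F_def G_def)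
  qed
qed

lemma cocommutative_if_gens:
  assumes comult: "algebra_hom P (tensor_algebra P P) \<Delta>"
    and gens: "\<And>g. g \<in> L \<Longrightarrow> \<Delta> (gen g) = tensor_flip P P (\<Delta> (gen g))"
  shows "cocommutative P \<Delta>"
proof -
  note P = complex_algebra_presented
  have "\<Delta> a = tensor_flip P P (\<Delta> a)" if "a \<in> carrier P" for a
    using comult algebra_hom_compose[OF comult tensor_flip_hom[OF P P]] gens that
    by (rule presented_hom_eqI[OF complex_algebra_tensor[OF P P]])
  thus ?thesis by (simp add: cocommutative_def)
qed

end

section \<open>The extended quantum space\<close>

text \<open>
  Relators of the form \<open>v - c w\<close> express the equations \<open>v = c w\<close> between monomials.
\<close>
lemma (in presentation) relation_eval:
  assumes "Poly_Mapping.single v 1 - Poly_Mapping.single w c \<in> R" "v \<in> lists L" "w \<in> lists L"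
  shows "eval_word P gen v = c \<odot>\<^bsub>P\<^esub> eval_word P gen w"
proof -
  note P = complex_algebra_presented
  interpret P: complex_algebra P by (rule P)
  have gens: "gen \<in> L \<rightarrow> carrier P" by (auto intro: presented_gen_closed)
  note closed = eval_word_closed[OF P gens]
  have "Poly_Mapping.single v 1 - Poly_Mapping.single w c
      = Poly_Mapping.single v 1 \<oplus>\<^bsub>free_algebra L\<^esub> Poly_Mapping.single w (- c)"
    by (simp add: free_algebra_def single_uminus)
  hence "\<zero>\<^bsub>P\<^esub> = I +>\<^bsub>free_algebra L\<^esub> (Poly_Mapping.single v 1 \<oplus>\<^bsub>free_algebra L\<^esub> Poly_Mapping.single w (- c))"
    using presented_relation[OF assms(1)] by simp
  also have "\<dots> = 1 \<odot>\<^bsub>P\<^esub> eval_word P gen v \<oplus>\<^bsub>P\<^esub> (- c) \<odot>\<^bsub>P\<^esub> eval_word P gen w"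
    using assms(2,3)
    by (subst algebra_homD(2)[OF algebra_hom_presented_coset]) (simp_all add: coset_word)
  finally have "eval_word P gen v \<oplus>\<^bsub>P\<^esub> (- 1) \<odot>\<^bsub>P\<^esub> (c \<odot>\<^bsub>P\<^esub> eval_word P gen w) = \<zero>\<^bsub>P\<^esub>"
    using closed[OF assms(2)] closed[OF assms(3)] by (simp add: P.scale_scale)
  with closed[OF assms(2)] P.scale_closed[OF closed[OF assms(3)]] show ?thesis
    by (rule P.add_eq_zero_imp_eq)
qed

locale ext_quantum_space =
  fixes n :: nat and q :: complex
  assumes n: "n \<ge> 1" and q: "q \<noteq> 0"
begin

abbreviation "relators_q \<equiv> qspace_relators n q \<union> inverse_relators"

lemma gens_iff [simp]:
  "X i \<in> ext_qspace_gens n \<longleftrightarrow> i \<in> {1..n}" "X1inv \<in> ext_qspace_gens n"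
  by (auto simp: ext_qspace_gens_def)

sublocale presentation "ext_qspace_gens n" relators_q
proof
  show "relators_q \<subseteq> carrier (free_algebra (ext_qspace_gens n))"
  proof
    fix r assume "r \<in> relators_q"
    then show "r \<in> carrier (free_algebra (ext_qspace_gens n))"
      unfolding qspace_relators_def inverse_relators_def
      by (elim UnE CollectE exE conjE insertE emptyE) (use n in \<open>simp_all add: keys_diff_subset\<close>)
  qed
qed

abbreviation "Aq \<equiv> ext_qspace n q"
abbreviation "x \<equiv> qx n q"
abbreviation "y \<equiv> qx1inv n q"

lemma gen_eq: "gen (X i) = x i" "gen X1inv = y" "P = Aq"
  by (simp_all add: qx_def qx1inv_def ext_qspace_def)

lemma complex_algebra_ext_qspace: "complex_algebra Aq"
  using complex_algebra_presented by (simp only: gen_eq)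

sublocale Aq: complex_algebra Aq
  by (rule complex_algebra_ext_qspace)

lemma x_closed [simp]: "i \<in> {1..n} \<Longrightarrow> x i \<in> carrier Aq"
  using presented_gen_closed[of "X i"] by (simp only: gen_eq gens_iff)

lemma y_closed [simp]: "y \<in> carrier Aq"
  using presented_gen_closed[of X1inv] by (simp only: gen_eq gens_iff)

lemma one_in [simp]: "1 \<in> {1..n}" "Suc 0 \<in> {1..n}"
  using n by auto

lemma x_comm:
  assumes "i \<in> {1..n}" "j \<in> {1..n}"
  shows "x i \<otimes>\<^bsub>Aq\<^esub> x j = (q powi (int j - int i)) \<odot>\<^bsub>Aq\<^esub> (x j \<otimes>\<^bsub>Aq\<^esub> x i)"
proof -
  have "Poly_Mapping.single [X i, X j] 1
      - Poly_Mapping.single [X j, X i] (q powi (int j - int i)) \<in> relators_q"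
    unfolding qspace_relators_def eta_unit_vec[OF assms, of q, symmetric] using assms by blast
  from relation_eval[OF this] show ?thesis
    using assms unfolding gen_eq by (simp add: gen_eq del: One_nat_def)
qed

lemma x_y: "x 1 \<otimes>\<^bsub>Aq\<^esub> y = \<one>\<^bsub>Aq\<^esub>" and y_x: "y \<otimes>\<^bsub>Aq\<^esub> x 1 = \<one>\<^bsub>Aq\<^esub>"
proof -
  have "Poly_Mapping.single [X 1, X1inv] 1 - Poly_Mapping.single [] 1 \<in> relators_q"
    "Poly_Mapping.single [X1inv, X 1] 1 - Poly_Mapping.single [] 1 \<in> relators_q"
    unfolding inverse_relators_def by blast+
  from this[THEN relation_eval] show "x 1 \<otimes>\<^bsub>Aq\<^esub> y = \<one>\<^bsub>Aq\<^esub>" "y \<otimes>\<^bsub>Aq\<^esub> x 1 = \<one>\<^bsub>Aq\<^esub>"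
    unfolding gen_eq using n by (simp_all add: gen_eq del: One_nat_def)
qed

lemma y_x_comm:
  assumes "i \<in> {1..n}"
  shows "y \<otimes>\<^bsub>Aq\<^esub> x i = (q powi (1 - int i)) \<odot>\<^bsub>Aq\<^esub> (x i \<otimes>\<^bsub>Aq\<^esub> y)"
proof -
  have "y \<otimes>\<^bsub>Aq\<^esub> x i = y \<otimes>\<^bsub>Aq\<^esub> (x i \<otimes>\<^bsub>Aq\<^esub> x 1) \<otimes>\<^bsub>Aq\<^esub> y"
    using assms x_closed[OF one_in(1)] by (simp add: Aq.m_assoc x_y del: One_nat_def)
  also have "\<dots> = (q powi (1 - int i)) \<odot>\<^bsub>Aq\<^esub> ((y \<otimes>\<^bsub>Aq\<^esub> x 1) \<otimes>\<^bsub>Aq\<^esub> x i \<otimes>\<^bsub>Aq\<^esub> y)"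
    using assms x_closed[OF one_in(1)] x_comm[OF assms one_in(1)]
    by (simp add: Aq.m_assoc Aq.smult_mult_left Aq.smult_mult_right del: One_nat_def)
  finally show ?thesis using assms by (simp add: y_x del: One_nat_def)
qed

lemma ext_qspace_lift:
  assumes B: "complex_algebra B"
    and u: "\<And>i. i \<in> {1..n} \<Longrightarrow> u i \<in> carrier B" and v: "v \<in> carrier B"
    and comm: "\<And>i j. i \<in> {1..n} \<Longrightarrow> j \<in> {1..n} \<Longrightarrow>
      u i \<otimes>\<^bsub>B\<^esub> u j = (q powi (int j - int i)) \<odot>\<^bsub>B\<^esub> (u j \<otimes>\<^bsub>B\<^esub> u i)"
    and inv: "u 1 \<otimes>\<^bsub>B\<^esub> v = \<one>\<^bsub>B\<^esub>" "v \<otimes>\<^bsub>B\<^esub> u 1 = \<one>\<^bsub>B\<^esub>"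
  shows "\<exists>h. algebra_hom Aq B h \<and> (\<forall>i\<in>{1..n}. h (x i) = u i) \<and> h y = v"
proof -
  interpret B: complex_algebra B by (rule B)
  define \<phi> where "\<phi> = (\<lambda>g. case g of X i \<Rightarrow> u i | X1inv \<Rightarrow> v)"
  have \<phi>_simps [simp]: "\<phi> (X i) = u i" "\<phi> X1inv = v" for i by (simp_all add: \<phi>_def)
  have \<phi>: "\<phi> \<in> ext_qspace_gens n \<rightarrow> carrier B"
    using u v by (auto simp: ext_qspace_gens_def)
  have words: "eval_word B \<phi> \<in> lists (ext_qspace_gens n) \<rightarrow> carrier B"
    using eval_word_closed[OF B \<phi>] by blast
  have u1: "u 1 \<in> carrier B" using u n by simp
  have "lin_ext B (eval_word B \<phi>) r = \<zero>\<^bsub>B\<^esub>" if "r \<in> relators_q" for r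
    using that unfolding qspace_relators_def inverse_relators_def
  proof (elim UnE CollectE exE conjE insertE emptyE)
    fix i j assume r: "r = Poly_Mapping.single [X i, X j] 1
        - Poly_Mapping.single [X j, X i] (eta n q (unit_vec i) (unit_vec j))"
      and ij: "i \<in> {1..n}" "j \<in> {1..n}"
    show ?thesis unfolding r
      by (rule B.lin_ext_diff_eq_zero[OF words])
        (use ij u comm[OF ij] in \<open>simp_all add: B.lin_ext_single eta_unit_vec\<close>)
  next
    assume r: "r = Poly_Mapping.single [X 1, X1inv] 1 - Poly_Mapping.single [] 1"
    show ?thesis unfolding r
      by (rule B.lin_ext_diff_eq_zero[OF words])
        (use u1 v inv n in \<open>simp_all add: B.lin_ext_single\<close>)
  next
    assume r: "r = Poly_Mapping.single [X1inv, X 1] 1 - Poly_Mapping.single [] 1"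
    show ?thesis unfolding r
      by (rule B.lin_ext_diff_eq_zero[OF words])
        (use u1 v inv n in \<open>simp_all add: B.lin_ext_single\<close>)
  qed
  from presented_lift[OF B \<phi> this] obtain h where
    h: "algebra_hom P B h" "\<And>g. g \<in> ext_qspace_gens n \<Longrightarrow> h (gen g) = \<phi> g" by blast
  have "h (x i) = u i" if "i \<in> {1..n}" for i
    using h(2)[of "X i"] that by (simp add: gen_eq)
  moreover have "h y = v"
    using h(2)[of X1inv] by (simp add: gen_eq)
  ultimately show ?thesis using h(1) by (auto simp: gen_eq)
qed

text \<open>The value on \<open>y\<close> is determined because homomorphisms preserve inverses.\<close>

lemma ext_qspace_hom_y:
  assumes B: "complex_algebra B" and f: "algebra_hom Aq B f"
    and v: "v \<in> carrier B" "f (x 1) \<otimes>\<^bsub>B\<^esub> v = \<one>\<^bsub>B\<^esub>"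
  shows "f y = v"
proof -
  interpret B: complex_algebra B by (rule B)
  note f' = algebra_homD[OF f] and x1 = x_closed[OF one_in(1)]
  have "f y \<otimes>\<^bsub>B\<^esub> f (x 1) = \<one>\<^bsub>B\<^esub>"
    unfolding f'(4)[OF y_closed x1, symmetric] y_x by (rule f'(5))
  from B.inv_unique[OF this v(2)] show ?thesis
    using f'(1)[OF y_closed] f'(1)[OF x1] v(1) by blast
qed

text \<open>
  Agreement on \<open>x\<^sub>1\<close> forces agreement on its inverse.
\<close>
lemma ext_qspace_hom_eqI:
  assumes B: "complex_algebra B" and f: "algebra_hom Aq B f" and g: "algebra_hom Aq B g"
    and eq: "\<And>i. i \<in> {1..n} \<Longrightarrow> f (x i) = g (x i)"
    and a: "a \<in> carrier Aq"
  shows "f a = g a"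
proof -
  note g' = algebra_homD[OF g] and x1 = x_closed[OF one_in(1)]
  have "f (x 1) \<otimes>\<^bsub>B\<^esub> g y = \<one>\<^bsub>B\<^esub>"
    unfolding eq[OF one_in(1)] g'(4)[OF x1 y_closed, symmetric] x_y by (rule g'(5))
  hence "f y = g y"
    by (rule ext_qspace_hom_y[OF B f g'(1)[OF y_closed]])
  hence "f (gen z) = g (gen z)" if "z \<in> ext_qspace_gens n" for z
    using that eq by (cases z) (simp_all add: gen_eq)
  thus ?thesis
    using presented_hom_eqI[OF B, of f g a] f g a by (simp add: gen_eq)
qed

text \<open>
  A homomorphism out of the extended quantum space is a family of elements with the same commutation
  relations, the first of which is invertible.
\<close>
lemma ext_qspace_universal:
  assumes B: "complex_algebra B"
    and u: "\<And>i. i \<in> {1..n} \<Longrightarrow> u i \<in> carrier B" and v: "v \<in> carrier B"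
    and comm: "\<And>i j. i \<in> {1..n} \<Longrightarrow> j \<in> {1..n} \<Longrightarrow>
      u i \<otimes>\<^bsub>B\<^esub> u j = (q powi (int j - int i)) \<odot>\<^bsub>B\<^esub> (u j \<otimes>\<^bsub>B\<^esub> u i)"
    and inv: "u 1 \<otimes>\<^bsub>B\<^esub> v = \<one>\<^bsub>B\<^esub>" "v \<otimes>\<^bsub>B\<^esub> u 1 = \<one>\<^bsub>B\<^esub>"
  shows "\<exists>!h. h \<in> extensional (carrier Aq)
    \<and> algebra_hom Aq B h \<and> (\<forall>i\<in>{1..n}. h (x i) = u i) \<and> h y = v"
proof -
  from ext_qspace_lift[OF assms] obtain h where
    h: "algebra_hom Aq B h" "\<forall>i\<in>{1..n}. h (x i) = u i" "h y = v" by blast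
  show ?thesis
  proof (rule ex1I[of _ "restrict h (carrier Aq)"])
    show "restrict h (carrier Aq) \<in> extensional (carrier Aq)
      \<and> algebra_hom Aq B (restrict h (carrier Aq))
      \<and> (\<forall>i\<in>{1..n}. restrict h (carrier Aq) (x i) = u i) \<and> restrict h (carrier Aq) y = v"
      using h(2,3) algebra_hom_restrict[OF complex_algebra_ext_qspace h(1)] by simp
    fix f assume f: "f \<in> extensional (carrier Aq)
      \<and> algebra_hom Aq B f \<and> (\<forall>i\<in>{1..n}. f (x i) = u i) \<and> f y = v"
    have "f a = h a" if "a \<in> carrier Aq" for a
      using ext_qspace_hom_eqI[OF B, of f h a] f h(1,2) that by metis
    thus "f = restrict h (carrier Aq)"
      using f by (intro extensionalityI[of f "carrier Aq"]) simp_all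
  qed
qed

text \<open>
  Both sides acquire the same factor \<open>c d\<close>.
\<close>
lemma scaled_comm:
  assumes B: "complex_algebra B" and "a \<in> carrier B" "b \<in> carrier B"
    and "a \<otimes>\<^bsub>B\<^esub> b = k \<odot>\<^bsub>B\<^esub> (b \<otimes>\<^bsub>B\<^esub> a)"
  shows "(c \<odot>\<^bsub>B\<^esub> a) \<otimes>\<^bsub>B\<^esub> (d \<odot>\<^bsub>B\<^esub> b) = k \<odot>\<^bsub>B\<^esub> ((d \<odot>\<^bsub>B\<^esub> b) \<otimes>\<^bsub>B\<^esub> (c \<odot>\<^bsub>B\<^esub> a))"
proof -
  interpret B: complex_algebra B by (rule B)
  show ?thesis
    using assms(2-4)
    by (simp add: B.smult_mult_left B.smult_mult_right B.scale_scale mult_ac)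
qed

lemma index_cases:
  assumes "i \<in> {1..n}"
  obtains "i = 1" | "1 < i" "i \<le> n" "i \<noteq> 1"
  using assms by force

subsection \<open>The coproduct\<close>

sublocale T: algebra_pair Aq Aq
  by (rule algebra_pairI) (rule complex_algebra_ext_qspace)+

text \<open>
  The prescribed coproduct of \<open>x\<^sub>i\<close> for \<open>i > 1\<close>. The formula is used for \<open>i = 1\<close> too, where it gives
  twice the prescribed value.
\<close>
abbreviation "skew_primitive i \<equiv> T.tens (x i) (x 1) \<oplus>\<^bsub>T.T\<^esub> T.tens (x 1) (x i)"

text \<open>
  The products have four terms each. In the outer two, \<open>x\<^sub>i\<close> and \<open>x\<^sub>j\<close> meet in the same tensor factor
  and commute with the factor \<open>q\<^bsup>j-i\<^esup>\<close>. The two mixed terms are exchanged; each of them needs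
  \<open>x\<^sub>i x\<^sub>1 = q\<^bsup>1-i\<^esup> x\<^sub>1 x\<^sub>i\<close> in one tensor factor and \<open>x\<^sub>1 x\<^sub>j = q\<^bsup>j-1\<^esup> x\<^sub>j x\<^sub>1\<close> in the other, and the exponents
  add up to \<open>j - i\<close>.
\<close>
lemma skew_primitive_comm:
  assumes i: "i \<in> {1..n}" and j: "j \<in> {1..n}"
  shows "skew_primitive i \<otimes>\<^bsub>T.T\<^esub> skew_primitive j
    = (q powi (int j - int i)) \<odot>\<^bsub>T.T\<^esub> (skew_primitive j \<otimes>\<^bsub>T.T\<^esub> skew_primitive i)"
proof -
  note x1 = x_closed[OF one_in(1)] and xi = x_closed[OF i] and xj = x_closed[OF j]
  let ?e = "q powi (int j - int i)"
  \<comment> \<open>The factors of a mixed term, in either order.\<close>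
  have e: "q powi (int 1 - int i) * q powi (int j - int 1) = ?e"
    "q powi (int j - int 1) * q powi (int 1 - int i) = ?e"
    using q by (simp_all add: power_int_add[symmetric])
  have "T.tens (x i \<otimes>\<^bsub>Aq\<^esub> x j) (x 1 \<otimes>\<^bsub>Aq\<^esub> x 1) = ?e \<odot>\<^bsub>T.T\<^esub> T.tens (x j \<otimes>\<^bsub>Aq\<^esub> x i) (x 1 \<otimes>\<^bsub>Aq\<^esub> x 1)"
    "T.tens (x 1 \<otimes>\<^bsub>Aq\<^esub> x 1) (x i \<otimes>\<^bsub>Aq\<^esub> x j) = ?e \<odot>\<^bsub>T.T\<^esub> T.tens (x 1 \<otimes>\<^bsub>Aq\<^esub> x 1) (x j \<otimes>\<^bsub>Aq\<^esub> x i)"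
    unfolding x_comm[OF i j] using x1 xi xj
    by (simp_all add: T.tens_scale_left T.tens_scale_right del: One_nat_def)
  moreover have
    "T.tens (x i \<otimes>\<^bsub>Aq\<^esub> x 1) (x 1 \<otimes>\<^bsub>Aq\<^esub> x j) = ?e \<odot>\<^bsub>T.T\<^esub> T.tens (x 1 \<otimes>\<^bsub>Aq\<^esub> x i) (x j \<otimes>\<^bsub>Aq\<^esub> x 1)"
    "T.tens (x 1 \<otimes>\<^bsub>Aq\<^esub> x j) (x i \<otimes>\<^bsub>Aq\<^esub> x 1) = ?e \<odot>\<^bsub>T.T\<^esub> T.tens (x j \<otimes>\<^bsub>Aq\<^esub> x 1) (x 1 \<otimes>\<^bsub>Aq\<^esub> x i)"
    unfolding x_comm[OF i one_in(1)] x_comm[OF one_in(1) j] using x1 xi xj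
    by (simp_all only: T.tens_scale_left T.tens_scale_right Aq.scale_closed Aq.m_closed
        T.T.scale_scale T.tens_closed e)
  ultimately show ?thesis
    using x1 xi xj
    by (simp add: T.T.l_distr T.T.r_distr T.tens_mult T.T.scale_add_right T.T.a_ac del: One_nat_def)
qed

definition coproduct_value where
  "coproduct_value i = (if i = 1 then T.tens (x 1) (x 1) else skew_primitive i)"

lemma coproduct_value_scaled:
  assumes "i \<in> {1..n}"
  shows "coproduct_value i = (if i = 1 then 1/2 else 1) \<odot>\<^bsub>T.T\<^esub> skew_primitive i"
proof -
  have "(1/2) \<odot>\<^bsub>T.T\<^esub> skew_primitive 1 = (1/2 + 1/2) \<odot>\<^bsub>T.T\<^esub> T.tens (x 1) (x 1)"
    using x_closed[OF one_in(1)]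
    by (simp only: T.T.scale_add_left T.T.scale_add_right T.tens_closed)
  thus ?thesis
    using assms x_closed[OF one_in(1)] by (simp add: coproduct_value_def del: One_nat_def)
qed

lemma is_coproduct_iff:
  "is_coproduct n q \<Delta> \<longleftrightarrow> algebra_hom Aq T.T \<Delta>
    \<and> (\<forall>i\<in>{1..n}. \<Delta> (x i) = coproduct_value i) \<and> \<Delta> y = T.tens y y"
  using n unfolding is_coproduct_def Let_def coproduct_value_def
  by (auto elim: index_cases)

lemma coproduct_ex1: "\<exists>!\<Delta>. \<Delta> \<in> extensional (carrier Aq) \<and> is_coproduct n q \<Delta>"
  unfolding is_coproduct_iff
proof (rule ext_qspace_universal[OF T.complex_algebra_tensor])
  note x1 = x_closed[OF one_in(1)]
  show "coproduct_value i \<in> carrier T.T" if "i \<in> {1..n}" for i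
    using that x1 by (simp add: coproduct_value_def del: One_nat_def)
  show "T.tens y y \<in> carrier T.T" by simp
  show "coproduct_value 1 \<otimes>\<^bsub>T.T\<^esub> T.tens y y = \<one>\<^bsub>T.T\<^esub>" "T.tens y y \<otimes>\<^bsub>T.T\<^esub> coproduct_value 1 = \<one>\<^bsub>T.T\<^esub>"
    using x1 by (simp_all add: coproduct_value_def T.tens_mult x_y y_x T.tens_one del: One_nat_def)
  show "coproduct_value i \<otimes>\<^bsub>T.T\<^esub> coproduct_value j
      = (q powi (int j - int i)) \<odot>\<^bsub>T.T\<^esub> (coproduct_value j \<otimes>\<^bsub>T.T\<^esub> coproduct_value i)"
    if "i \<in> {1..n}" "j \<in> {1..n}" for i j
    unfolding coproduct_value_scaled[OF that(1)] coproduct_value_scaled[OF that(2)]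
    by (rule scaled_comm[OF T.complex_algebra_tensor])
      (use that x1 skew_primitive_comm[OF that] in \<open>simp_all del: One_nat_def\<close>)
qed

subsection \<open>The counit\<close>

text \<open>
  The value on \<open>y\<close> is inverse to the value on \<open>x\<^sub>1\<close>.
\<close>
lemma is_counit_iff:
  "is_counit n q \<epsilon> \<longleftrightarrow> algebra_hom Aq complex_alg \<epsilon>
    \<and> (\<forall>i\<in>{1..n}. \<epsilon> (x i) = (if i = 1 then 1 else 0)) \<and> \<epsilon> y = 1"
proof -
  have "\<epsilon> y = 1" if "algebra_hom Aq complex_alg \<epsilon>" "\<epsilon> (x 1) = 1"
    by (rule ext_qspace_hom_y[OF complex_algebra_complex_alg that(1)]) (simp_all add: that(2) del: One_nat_def)
  thus ?thesis
    using n unfolding is_counit_def by (auto elim: index_cases)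
qed

lemma counit_ex1: "\<exists>!\<epsilon>. \<epsilon> \<in> extensional (carrier Aq) \<and> is_counit n q \<epsilon>"
  unfolding is_counit_iff
  by (rule ext_qspace_universal[OF complex_algebra_complex_alg]) auto

subsection \<open>The antipode\<close>

text \<open>
  Up to sign the prescribed antipode of \<open>x\<^sub>i\<close>; at \<open>i = 1\<close> it is \<open>y\<close>.
\<close>
abbreviation "conj_x i \<equiv> y \<otimes>\<^bsub>Aq\<^esub> x i \<otimes>\<^bsub>Aq\<^esub> y"

text \<open>
  Moving \<open>y\<^sup>2\<close> past \<open>x\<^sub>i\<close> costs \<open>q\<^bsup>2(1-i)\<^esup>\<close>, so \<open>x\<^sub>j y\<^sup>2 x\<^sub>i = q\<^bsup>2(1-i)\<^esup> x\<^sub>j x\<^sub>i y\<^sup>2\<close>, while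
  \<open>x\<^sub>i y\<^sup>2 x\<^sub>j = q\<^bsup>2(1-j)\<^esup> q\<^bsup>j-i\<^esup> x\<^sub>j x\<^sub>i y\<^sup>2\<close>. The quotient of the two factors is again \<open>q\<^bsup>j-i\<^esup>\<close>. The factors on
  the left are in reverse order because the antipode is a homomorphism to the opposite algebra.
\<close>
lemma conj_x_comm:
  assumes i: "i \<in> {1..n}" and j: "j \<in> {1..n}"
  shows "conj_x j \<otimes>\<^bsub>Aq\<^esub> conj_x i = (q powi (int j - int i)) \<odot>\<^bsub>Aq\<^esub> (conj_x i \<otimes>\<^bsub>Aq\<^esub> conj_x j)"
proof -
  note xi = x_closed[OF i] and xj = x_closed[OF j]
  let ?w = "y \<otimes>\<^bsub>Aq\<^esub> y"
  let ?p = "\<lambda>i. q powi (1 - int i)"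
  have w: "?w \<otimes>\<^bsub>Aq\<^esub> x i = (?p i * ?p i) \<odot>\<^bsub>Aq\<^esub> (x i \<otimes>\<^bsub>Aq\<^esub> ?w)" if i: "i \<in> {1..n}" for i
  proof -
    note xi = x_closed[OF i]
    have "?w \<otimes>\<^bsub>Aq\<^esub> x i = y \<otimes>\<^bsub>Aq\<^esub> (y \<otimes>\<^bsub>Aq\<^esub> x i)"
      using xi by (simp add: Aq.m_assoc)
    also have "\<dots> = ?p i \<odot>\<^bsub>Aq\<^esub> (y \<otimes>\<^bsub>Aq\<^esub> (x i \<otimes>\<^bsub>Aq\<^esub> y))"
      using xi by (simp add: y_x_comm[OF i] Aq.smult_mult_right)
    also have "\<dots> = ?p i \<odot>\<^bsub>Aq\<^esub> ((y \<otimes>\<^bsub>Aq\<^esub> x i) \<otimes>\<^bsub>Aq\<^esub> y)"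
      using xi by (simp add: Aq.m_assoc)
    also have "\<dots> = (?p i * ?p i) \<odot>\<^bsub>Aq\<^esub> (x i \<otimes>\<^bsub>Aq\<^esub> ?w)"
      using xi by (simp add: y_x_comm[OF i] Aq.smult_mult_left Aq.scale_scale Aq.m_assoc)
    finally show ?thesis .
  qed
  have swap: "x i \<otimes>\<^bsub>Aq\<^esub> (?w \<otimes>\<^bsub>Aq\<^esub> x j)
      = (?p j * ?p j * q powi (int j - int i)) \<odot>\<^bsub>Aq\<^esub> (x j \<otimes>\<^bsub>Aq\<^esub> x i \<otimes>\<^bsub>Aq\<^esub> ?w)"
    using xi xj
    by (simp add: w[OF j] Aq.smult_mult_right Aq.m_assoc[symmetric] x_comm[OF i j]
        Aq.smult_mult_left Aq.scale_scale)
  have "?p i * ?p i = q powi (int j - int i) * (?p j * ?p j * q powi (int j - int i))"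
    using q by (simp add: power_int_add[symmetric])
  hence "x j \<otimes>\<^bsub>Aq\<^esub> (?w \<otimes>\<^bsub>Aq\<^esub> x i) = (q powi (int j - int i)) \<odot>\<^bsub>Aq\<^esub> (x i \<otimes>\<^bsub>Aq\<^esub> (?w \<otimes>\<^bsub>Aq\<^esub> x j))"
    unfolding swap using xi xj
    by (simp add: w[OF i] Aq.smult_mult_right Aq.m_assoc Aq.scale_scale)
  hence "y \<otimes>\<^bsub>Aq\<^esub> (x j \<otimes>\<^bsub>Aq\<^esub> (?w \<otimes>\<^bsub>Aq\<^esub> x i)) \<otimes>\<^bsub>Aq\<^esub> y
      = (q powi (int j - int i)) \<odot>\<^bsub>Aq\<^esub> (y \<otimes>\<^bsub>Aq\<^esub> (x i \<otimes>\<^bsub>Aq\<^esub> (?w \<otimes>\<^bsub>Aq\<^esub> x j)) \<otimes>\<^bsub>Aq\<^esub> y)"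
    using xi xj by (simp add: Aq.smult_mult_left Aq.smult_mult_right)
  thus ?thesis using xi xj by (simp add: Aq.m_assoc)
qed

definition antipode_value where
  "antipode_value i = (if i = 1 then y else \<ominus>\<^bsub>Aq\<^esub> (conj_x i))"

lemma antipode_value_scaled:
  assumes "i \<in> {1..n}"
  shows "antipode_value i = (if i = 1 then 1 else - 1) \<odot>\<^bsub>Aq\<^esub> conj_x i"
  using assms by (simp add: antipode_value_def y_x Aq.scale_minus_one del: One_nat_def)

lemma is_antipode_iff:
  "is_antipode n q S \<longleftrightarrow> algebra_hom Aq (opposite_algebra Aq) S
    \<and> (\<forall>i\<in>{1..n}. S (x i) = antipode_value i) \<and> S y = x 1"
proof -
  have "S y = x 1" if "algebra_hom Aq (opposite_algebra Aq) S" "S (x 1) = y"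
    by (rule ext_qspace_hom_y[OF complex_algebra_opposite[OF complex_algebra_ext_qspace] that(1)])
      (use x_closed[OF one_in(1)] in \<open>simp_all add: that(2) x_y del: One_nat_def\<close>)
  thus ?thesis
    using n unfolding is_antipode_def Let_def antipode_value_def algebra_antihom_iff
    by (auto elim: index_cases)
qed

lemma antipode_ex1: "\<exists>!S. S \<in> extensional (carrier Aq) \<and> is_antipode n q S"
  unfolding is_antipode_iff
proof (rule ext_qspace_universal[OF complex_algebra_opposite[OF complex_algebra_ext_qspace]])
  note x1 = x_closed[OF one_in(1)]
  show "antipode_value i \<in> carrier (opposite_algebra Aq)" if "i \<in> {1..n}" for i
    using that by (simp add: antipode_value_def)
  show "x 1 \<in> carrier (opposite_algebra Aq)" using x1 by (simp del: One_nat_def)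
  show "antipode_value 1 \<otimes>\<^bsub>opposite_algebra Aq\<^esub> x 1 = \<one>\<^bsub>opposite_algebra Aq\<^esub>"
    "x 1 \<otimes>\<^bsub>opposite_algebra Aq\<^esub> antipode_value 1 = \<one>\<^bsub>opposite_algebra Aq\<^esub>"
    by (simp_all add: antipode_value_def x_y y_x del: One_nat_def)
  show "antipode_value i \<otimes>\<^bsub>opposite_algebra Aq\<^esub> antipode_value j
      = (q powi (int j - int i)) \<odot>\<^bsub>opposite_algebra Aq\<^esub> (antipode_value j \<otimes>\<^bsub>opposite_algebra Aq\<^esub> antipode_value i)"
    if "i \<in> {1..n}" "j \<in> {1..n}" for i j
    unfolding antipode_value_scaled[OF that(1)] antipode_value_scaled[OF that(2)]
      opposite_algebra_simps(5)[of Aq, symmetric]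
    by (rule scaled_comm[OF complex_algebra_opposite[OF complex_algebra_ext_qspace]])
      (use that conj_x_comm[OF that] in \<open>simp_all del: One_nat_def\<close>)
qed

subsection \<open>The Hopf algebra axioms\<close>

context
  fixes \<Delta> \<epsilon> S
  assumes \<Delta>: "is_coproduct n q \<Delta>" and \<epsilon>: "is_counit n q \<epsilon>" and S: "is_antipode n q S"
begin

lemmas hom_\<Delta> = conjunct1[OF \<Delta>[unfolded is_coproduct_iff]]
lemmas hom_\<epsilon> = conjunct1[OF \<epsilon>[unfolded is_counit_iff]]
lemmas hom_S = conjunct1[OF S[unfolded is_antipode_iff]]

lemma structure_values:
  "\<Delta> (x 1) = T.tens (x 1) (x 1)" "\<Delta> y = T.tens y y"
  "\<epsilon> (x 1) = 1" "\<epsilon> y = 1" "S (x 1) = y" "S y = x 1"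
  using \<Delta> \<epsilon> S n unfolding is_coproduct_iff is_counit_iff is_antipode_iff
    coproduct_value_def antipode_value_def by auto

lemma structure_values':
  assumes "1 < i" "i \<le> n"
  shows "\<Delta> (x i) = skew_primitive i" "\<epsilon> (x i) = 0" "S (x i) = \<ominus>\<^bsub>Aq\<^esub> (conj_x i)"
  using \<Delta> \<epsilon> S assms unfolding is_coproduct_iff is_counit_iff is_antipode_iff
    coproduct_value_def antipode_value_def by auto

lemma ext_gens_cases:
  assumes "g \<in> ext_qspace_gens n"
    and "Q (x 1)" "Q y" "\<And>i. 1 < i \<Longrightarrow> i \<le> n \<Longrightarrow> Q (x i)"
  shows "Q (gen g)"
proof (cases g)
  case (X i)
  with assms(1) have "i \<in> {1..n}" by simp
  thus ?thesis unfolding X gen_eq using assms(2,4) by (cases rule: index_cases) simp_all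
next
  case X1inv
  thus ?thesis using assms(3) by (simp add: gen_eq)
qed

text \<open>
  On the group-like generators \<open>x\<^sub>1\<close> and \<open>y\<close> all laws are immediate. On \<open>x\<^sub>i\<close> with \<open>i > 1\<close>, both sides of
  coassociativity are \<open>x\<^sub>i \<otimes> x\<^sub>1 \<otimes> x\<^sub>1 + x\<^sub>1 \<otimes> x\<^sub>i \<otimes> x\<^sub>1 + x\<^sub>1 \<otimes> x\<^sub>1 \<otimes> x\<^sub>i\<close>, and the antipode laws are
  the cancellations \<open>- y x\<^sub>i y x\<^sub>1 + y x\<^sub>i = 0\<close> and \<open>x\<^sub>i y - x\<^sub>1 y x\<^sub>i y = 0\<close>.
\<close>
lemma complex_hopf_algebra_ext_qspace: "complex_hopf_algebra Aq \<Delta> \<epsilon> S"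
proof -
  note A = complex_algebra_ext_qspace and C = complex_algebra_complex_alg
  note AA = complex_algebra_tensor[OF A A]
  note lin_id = algebra_homD(6)[OF algebra_hom_id[of Aq]]
    and lin_\<Delta> = algebra_homD(6)[OF hom_\<Delta>] and lin_\<epsilon> = algebra_homD(6)[OF hom_\<epsilon>]
  have antihom: "algebra_antihom Aq Aq S" using hom_S by (simp add: algebra_antihom_iff)
  interpret TL: algebra_pair T.T Aq by (rule algebra_pairI[OF AA A])
  interpret TR: algebra_pair Aq T.T by (rule algebra_pairI[OF A AA])
  note x1 [simp] = x_closed[OF one_in(1)]
  \<comment> \<open>Names for the six maps in the laws, so that each is described by its values on pure tensors.\<close>
  define \<Delta>L where "\<Delta>L = (\<lambda>t. tensor_assoc Aq Aq Aq (tensor_map T.T Aq \<Delta> id t))"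
  define \<Delta>R where "\<Delta>R = (\<lambda>t. tensor_map Aq T.T id \<Delta> t)"
  define \<epsilon>L where "\<epsilon>L = (\<lambda>t. tensor_unit_left Aq (tensor_map complex_alg Aq \<epsilon> id t))"
  define \<epsilon>R where "\<epsilon>R = (\<lambda>t. tensor_unit_right Aq (tensor_map Aq complex_alg id \<epsilon> t))"
  define SL where "SL = (\<lambda>t. tensor_mult Aq (tensor_map Aq Aq S id t))"
  define SR where "SR = (\<lambda>t. tensor_mult Aq (tensor_map Aq Aq id S t))"
  have lin: "linear_map T.T TR.T \<Delta>L" "linear_map T.T TR.T \<Delta>R" "linear_map T.T Aq \<epsilon>L"
    "linear_map T.T Aq \<epsilon>R" "linear_map T.T Aq SL" "linear_map T.T Aq SR"
    unfolding \<Delta>L_def \<Delta>R_def \<epsilon>L_def \<epsilon>R_def SL_def SR_def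
    by (rule linear_map_compose[OF tensor_map_linear[OF A A AA A lin_\<Delta> lin_id]
          algebra_homD(6)[OF tensor_assoc_hom[OF A A A]]],
        rule tensor_map_linear[OF A A A AA lin_id lin_\<Delta>],
        rule linear_map_compose[OF tensor_map_linear[OF A A C A lin_\<epsilon> lin_id]
          algebra_homD(6)[OF tensor_unit_left_hom[OF A]]],
        rule linear_map_compose[OF tensor_map_linear[OF A A A C lin_id lin_\<epsilon>]
          algebra_homD(6)[OF tensor_unit_right_hom[OF A]]],
        rule antipode_map_linear[OF A antihom], rule antipode_map_linear[OF A antihom])
  note add = lin[THEN linear_mapD(2)]
  have assoc: "\<Delta>L (T.tens a b) = tensor_assoc Aq Aq Aq (TL.tens (\<Delta> a) b)"
    and \<Delta>R: "\<Delta>R (T.tens a b) = TR.tens a (\<Delta> b)"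
    and \<epsilon>L: "\<epsilon>L (T.tens a b) = \<epsilon> a \<odot>\<^bsub>Aq\<^esub> b"
    and \<epsilon>R: "\<epsilon>R (T.tens a b) = \<epsilon> b \<odot>\<^bsub>Aq\<^esub> a"
    and SL: "SL (T.tens a b) = S a \<otimes>\<^bsub>Aq\<^esub> b"
    and SR: "SR (T.tens a b) = a \<otimes>\<^bsub>Aq\<^esub> S b"
    if "a \<in> carrier Aq" "b \<in> carrier Aq" for a b
    unfolding \<Delta>L_def \<Delta>R_def \<epsilon>L_def \<epsilon>R_def SL_def SR_def
      tensor_map_tens[OF A A AA A lin_\<Delta> lin_id that] tensor_map_tens[OF A A A AA lin_id lin_\<Delta> that]
      tensor_map_tens[OF A A C A lin_\<epsilon> lin_id that] tensor_map_tens[OF A A A C lin_id lin_\<epsilon> that]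
      antipode_map_tens[OF A antihom that]
    using that by (simp_all add: tensor_unit_left_tens[OF A] tensor_unit_right_tens[OF A])
  have assoc': "tensor_assoc Aq Aq Aq (TL.tens (T.tens a b) c) = TR.tens a (T.tens b c)"
    if "a \<in> carrier Aq" "b \<in> carrier Aq" "c \<in> carrier Aq" for a b c
    by (rule tensor_assoc_tens[OF A A A that])
  have assoc_add: "tensor_assoc Aq Aq Aq (TL.tens (s \<oplus>\<^bsub>T.T\<^esub> t) c)
      = tensor_assoc Aq Aq Aq (TL.tens s c) \<oplus>\<^bsub>TR.T\<^esub> tensor_assoc Aq Aq Aq (TL.tens t c)"
    if "s \<in> carrier T.T" "t \<in> carrier T.T" "c \<in> carrier Aq" for s t c
    using that by (simp add: TL.tens_add_left algebra_homD(2)[OF tensor_assoc_hom[OF A A A]])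
  have all: "\<Delta>L (\<Delta> (gen g)) = \<Delta>R (\<Delta> (gen g)) \<and> \<epsilon>L (\<Delta> (gen g)) = gen g \<and> \<epsilon>R (\<Delta> (gen g)) = gen g
      \<and> SL (\<Delta> (gen g)) = \<epsilon> (gen g) \<odot>\<^bsub>Aq\<^esub> \<one>\<^bsub>Aq\<^esub> \<and> SR (\<Delta> (gen g)) = \<epsilon> (gen g) \<odot>\<^bsub>Aq\<^esub> \<one>\<^bsub>Aq\<^esub>"
    if "g \<in> ext_qspace_gens n" for g
    using that
  proof (rule ext_gens_cases)
    fix i assume i: "1 < i" "i \<le> n"
    hence xi [simp]: "x i \<in> carrier Aq" by simp
    have "\<ominus>\<^bsub>Aq\<^esub> conj_x i \<otimes>\<^bsub>Aq\<^esub> x 1 = \<ominus>\<^bsub>Aq\<^esub> (y \<otimes>\<^bsub>Aq\<^esub> x i)"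
      using Aq.m_assoc[of "y \<otimes>\<^bsub>Aq\<^esub> x i" y "x 1"] by (simp add: Aq.l_minus y_x del: One_nat_def)
    moreover have "x 1 \<otimes>\<^bsub>Aq\<^esub> \<ominus>\<^bsub>Aq\<^esub> conj_x i = \<ominus>\<^bsub>Aq\<^esub> (x i \<otimes>\<^bsub>Aq\<^esub> y)"
      using Aq.m_assoc[of "x 1" y "x i \<otimes>\<^bsub>Aq\<^esub> y"] by (simp add: Aq.r_minus x_y Aq.m_assoc del: One_nat_def)
    ultimately show "\<Delta>L (\<Delta> (x i)) = \<Delta>R (\<Delta> (x i)) \<and> \<epsilon>L (\<Delta> (x i)) = x i \<and> \<epsilon>R (\<Delta> (x i)) = x i
      \<and> SL (\<Delta> (x i)) = \<epsilon> (x i) \<odot>\<^bsub>Aq\<^esub> \<one>\<^bsub>Aq\<^esub> \<and> SR (\<Delta> (x i)) = \<epsilon> (x i) \<odot>\<^bsub>Aq\<^esub> \<one>\<^bsub>Aq\<^esub>"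
      by (simp add: structure_values structure_values'[OF i] add assoc assoc' assoc_add \<Delta>R \<epsilon>L \<epsilon>R SL SR
          TR.tens_add_right TR.T.a_assoc Aq.l_neg Aq.r_neg del: One_nat_def)
  qed (simp_all add: structure_values assoc assoc' \<Delta>R \<epsilon>L \<epsilon>R SL SR x_y y_x del: One_nat_def)
  show ?thesis
    by (rule hopf_algebra_if_gens[unfolded gen_eq(3), OF hom_\<Delta> hom_\<epsilon> antihom])
      (use all in \<open>unfold \<Delta>L_def \<Delta>R_def \<epsilon>L_def \<epsilon>R_def SL_def SR_def, blast+\<close>)
qed

lemma cocommutative_ext_qspace: "cocommutative Aq \<Delta>"
proof (rule cocommutative_if_gens[unfolded gen_eq(3), OF hom_\<Delta>])
  note A = complex_algebra_ext_qspace
  note flip = tensor_flip_tens[OF A A] algebra_homD(2)[OF tensor_flip_hom[OF A A]]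
  note x1 [simp] = x_closed[OF one_in(1)]
  fix g assume "g \<in> ext_qspace_gens n"
  thus "\<Delta> (gen g) = tensor_flip Aq Aq (\<Delta> (gen g))"
  proof (rule ext_gens_cases)
    fix i assume i: "1 < i" "i \<le> n"
    hence "x i \<in> carrier Aq" by simp
    thus "\<Delta> (x i) = tensor_flip Aq Aq (\<Delta> (x i))"
      by (simp add: structure_values'[OF i] flip T.T.a_comm del: One_nat_def)
  qed (simp_all add: structure_values flip del: One_nat_def)
qed

end

end

theorem theorem3p1:
  fixes n :: nat and q :: complex
  assumes "n \<ge> 1" and "q \<noteq> 0"
  shows "(\<exists>!\<Delta>. \<Delta> \<in> extensional (carrier (ext_qspace n q)) \<and> is_coproduct n q \<Delta>)
       \<and> (\<exists>!\<epsilon>. \<epsilon> \<in> extensional (carrier (ext_qspace n q)) \<and> is_counit n q \<epsilon>)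
       \<and> (\<exists>!S. S \<in> extensional (carrier (ext_qspace n q)) \<and> is_antipode n q S)
       \<and> (\<forall>\<Delta> \<epsilon> S. is_coproduct n q \<Delta> \<and> is_counit n q \<epsilon> \<and> is_antipode n q S \<longrightarrow>
            complex_hopf_algebra (ext_qspace n q) \<Delta> \<epsilon> S \<and> cocommutative (ext_qspace n q) \<Delta>)"
proof -
  interpret ext_quantum_space n q
    using assms by unfold_locales
  show ?thesis
    by (intro conjI coproduct_ex1 counit_ex1 antipode_ex1 allI impI; elim conjE)
      (rule complex_hopf_algebra_ext_qspace cocommutative_ext_qspace; assumption)+
qed

end
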